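(* Let $k$ be a positive integer and let $G$ be a non-bipartite graph. If $G$ contains none of the cycles $C_3,C_5,\ldots,C_{2k+1}$ as a subgraph, then $$\lambda_1^{2k}\leqslant \frac{\operatorname{Tr}(A^{2k}(G))}{2}-\left(2\cos\frac{\pi}{k+2}\right)^{2k}.$$ Equality holds if and only if $k=1$ and $G$ is isomorphic to the cycle $C_5$ together with some (possibly zero) isolated vertices.
   Context: All graphs are finite, simple and undirected. $A(G)$ is the adjacency matrix of $G$ and $\lambda_1$ its largest eigenvalue (the spectral radius of $G$); $\operatorname{Tr}$ denotes the trace. $C_m$ is the cycle on $m$ vertices. *)

theory Defs
  imports
    "Graph_Theory.Pair_Digraph"
    "Graph_Theory.Digraph_Isomorphism"
    "Jordan_Normal_Form.Spectral_Radius"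
begin

text \<open>
  A finite simple undirected graph is an \<^typ>\<open>'a pair_pre_digraph\<close> satisfying the library locale
  \<^locale>\<open>pair_graph\<close>: finite, loopless, and with a symmetric set of arcs, so that an edge
  \<open>uv\<close> is represented by the two arcs \<open>(u, v)\<close> and \<open>(v, u)\<close>.
\<close>

definition bipartite :: "'a pair_pre_digraph \<Rightarrow> bool" where
  "bipartite G \<longleftrightarrow>
    (\<exists>U W. pverts G = U \<union> W \<and> U \<inter> W = {} \<and> parcs G \<subseteq> U \<times> W \<union> W \<times> U)"

text \<open>A simple graph, and the cycle on \<open>m\<close> vertices, only for \<open>m \<ge> 3\<close>.\<close>

definition cycle_graph :: "nat \<Rightarrow> nat pair_pre_digraph" where
  "cycle_graph m = \<lparr> pverts = {..<m},
     parcs = {(i, j). i < m \<and> j < m \<and> (j = Suc i mod m \<or> i = Suc j mod m)} \<rparr>"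

text \<open>Containment as a not necessarily induced subgraph, up to isomorphism.\<close>

definition contains_subgraph :: "'a pair_pre_digraph \<Rightarrow> 'b pair_pre_digraph \<Rightarrow> bool" where
  "contains_subgraph G F \<longleftrightarrow>
    (\<exists>H. subgraph H (with_proj G) \<and> digraph_iso (with_proj F) H)"

definition add_isolated :: "nat \<Rightarrow> 'a pair_pre_digraph \<Rightarrow> ('a + nat) pair_pre_digraph" where
  "add_isolated s G = \<lparr> pverts = pverts G <+> {..<s}, parcs = map_prod Inl Inl ` parcs G \<rparr>"

text \<open>
  Rows and columns are indexed by positions in a list \<open>vs\<close>, meant to enumerate the vertices
  without repetition.
\<close>

definition adjacency_matrix :: "'a list \<Rightarrow> 'a pair_pre_digraph \<Rightarrow> real mat" where
  "adjacency_matrix vs G =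
    mat (length vs) (length vs) (\<lambda>(i, j). if (vs ! i, vs ! j) \<in> parcs G then 1 else 0)"

definition mat_trace :: "'a :: comm_monoid_add mat \<Rightarrow> 'a" where
  "mat_trace A = (\<Sum>i<dim_row A. A $$ (i, i))"

text \<open>
  Only real eigenvalues are considered, which are all of them for a symmetric matrix. For the
  \<open>0 \<times> 0\<close> matrix the value is unspecified.
\<close>

definition largest_eigenvalue :: "real mat \<Rightarrow> real" where
  "largest_eigenvalue A = Max (spectrum A)"

end

theory Submission
  imports Defs "HOL-Analysis.Function_Topology" "HOL-Analysis.Convex"
begin

text \<open>
  Let \<open>C\<close> be a shortest odd cycle, of length \<open>g \<ge> 2k + 3\<close>, and \<open>c = 2 cos (\<pi> / (k + 2))\<close>, the largest
  eigenvalue of the path on \<open>k + 1\<close> vertices.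

  For \<open>k = 1\<close>, \<open>\<lambda>\<^sub>1\<^sup>2\<close> is at most the largest row sum of \<open>A\<^sup>2\<close>. In a triangle-free graph with \<open>e\<close> edges the
  row sum at \<open>v\<close> is \<open>e\<close> minus the number of edges avoiding the neighbourhood of \<open>v\<close>, and \<open>C\<close> always
  supplies such an edge.

  For \<open>k \<ge> 2\<close> the inequality is strict. As \<open>Tr A\<^bsup>2k+1\<^esup> = 0\<close>, a convexity argument on the eigenvalues gives
  \<open>Tr A\<^bsup>2k\<^esup> \<ge> 2 (\<lambda>\<^sub>1\<^bsup>2k\<^esup> + c\<^bsup>2k\<^esup>)\<close> as soon as \<open>\<lambda>\<^sub>2 \<ge> c\<close>, and equality would make the spectrum symmetric,
  contradicting \<open>Tr A\<^bsup>g\<^esup> > 0\<close>. To see that \<open>\<lambda>\<^sub>2 \<ge> c\<close>, it suffices to find two disjoint sets of vertices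
  without edges between them whose induced subgraphs both have an eigenvalue at least \<open>c\<close>. Two
  paths on \<open>k + 1\<close> vertices do, and they fit into \<open>C\<close> when \<open>g \<ge> 2k + 5\<close>. When \<open>g = 2k + 3\<close>, they fit into
  \<open>C\<close> together with an adjacent vertex, except that if this vertex has two neighbours on \<open>C\<close> one
  path is replaced by a fork. If no vertex is attached to \<open>C\<close>, then \<open>2\<close> is an eigenvalue; either it is
  not the largest one and \<open>\<lambda>\<^sub>2 \<ge> 2\<close>, or \<open>\<lambda>\<^sub>1 = 2\<close> and counting the closed walks inside \<open>C\<close> is enough.
\<close>

section \<open>Spectral decomposition of symmetric forms\<close>

text \<open>Compactness of the unit sphere gives a maximizer of the quadratic form, and homogeneity
  extends the bound from the sphere to all \<open>y\<close>.\<close>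

lemma rayleigh_maximizer:
  fixes a :: "'v \<Rightarrow> 'v \<Rightarrow> real"
  assumes fin: "finite V" and ne: "V \<noteq> {}"
  obtains x where "(\<Sum>v\<in>V. (x v)\<^sup>2) = 1"
    and "\<And>y. (\<Sum>v\<in>V. \<Sum>w\<in>V. a v w * y v * y w)
           \<le> (\<Sum>v\<in>V. \<Sum>w\<in>V. a v w * x v * x w) * (\<Sum>v\<in>V. (y v)\<^sup>2)"
proof -
  define q where "q = (\<lambda>x. \<Sum>v\<in>V. \<Sum>w\<in>V. a v w * x v * x w)"
  \<comment> \<open>The vertex type may be infinite. Pinning the coordinates outside
    \<open>V\<close> to 0 makes \<open>B\<close> a product of compact sets, and the sphere is closed
    in it.\<close>
  define B where "B = (\<Pi>\<^sub>E v\<in>UNIV. if v \<in> V then {-1..1::real} else {0})"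
  define S where "S = B \<inter> {x. (\<Sum>v\<in>V. (x v)\<^sup>2) = 1}"
  have "compactin (product_topology (\<lambda>_. euclidean) UNIV) B"
    unfolding B_def compactin_PiE by simp
  then have "compact B"
    by (simp add: euclidean_product_topology)
  moreover have "closed {x. (\<Sum>v\<in>V. (x v :: real)\<^sup>2) = 1}"
    by (intro closed_Collect_eq continuous_intros continuous_on_product_coordinates)
  ultimately have S: "compact S"
    unfolding S_def by (rule compact_Int_closed)
  have cont: "continuous_on S q"
    unfolding q_def
    by (intro continuous_intros continuous_on_subset[OF continuous_on_product_coordinates]) auto
  obtain v0 where v0: "v0 \<in> V" using ne by blast
  have "(\<lambda>v. if v = v0 then 1 else 0) \<in> S"
  proof -
    have "(\<Sum>v\<in>V. ((if v = v0 then 1 else 0)::real)\<^sup>2) = (\<Sum>v\<in>V. if v = v0 then 1 else 0)"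
      by (rule sum.cong) auto
    then show ?thesis
      using v0 fin by (auto simp: S_def B_def)
  qed
  then have "S \<noteq> {}" by blast
  then obtain x where x: "x \<in> S" and mx: "\<And>z. z \<in> S \<Longrightarrow> q z \<le> q x"
    using continuous_attains_sup[OF S _ cont] by blast
  have "q y \<le> q x * (\<Sum>v\<in>V. (y v)\<^sup>2)" for y
  proof (cases "\<forall>v\<in>V. y v = 0")
    case True
    then show ?thesis by (simp add: q_def)
  next
    case False
    define N where "N = (\<Sum>v\<in>V. (y v)\<^sup>2)"
    have Npos: "N > 0"
      using False fin unfolding N_def by (metis sum_pos2 zero_le_power2 zero_less_power2)
    define s where "s = sqrt N"
    have s: "s > 0" "s\<^sup>2 = N" using Npos by (auto simp: s_def)
    define z where "z = (\<lambda>v. if v \<in> V then y v / s else 0)"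
    have z1: "(\<Sum>v\<in>V. (z v)\<^sup>2) = 1"
    proof -
      have "(\<Sum>v\<in>V. (z v)\<^sup>2) = (\<Sum>v\<in>V. (y v)\<^sup>2 / N)"
        by (rule sum.cong) (auto simp: z_def power_divide s)
      also have "\<dots> = 1" using Npos by (simp add: N_def flip: sum_divide_distrib)
      finally show ?thesis .
    qed
    have "\<bar>z v\<bar> \<le> 1" if "v \<in> V" for v
    proof -
      have "(z v)\<^sup>2 \<le> (\<Sum>v\<in>V. (z v)\<^sup>2)" using that fin by (intro member_le_sum) auto
      then show ?thesis using z1 by (simp add: abs_square_le_1)
    qed
    then have "- 1 \<le> z v \<and> z v \<le> 1" if "v \<in> V" for v
      using that abs_le_iff minus_le_iff by blast
    moreover have "z v = 0" if "v \<notin> V" for v using that by (simp add: z_def)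
    ultimately have "z \<in> S" using z1 by (auto simp: S_def B_def)
    then have "q z \<le> q x" by (rule mx)
    moreover have "q z = q y / N"
    proof -
      have "q z = (\<Sum>v\<in>V. \<Sum>w\<in>V. a v w * y v * y w / N)"
        unfolding q_def
        by (intro sum.cong refl) (auto simp: z_def s(2)[symmetric] power2_eq_square)
      then show ?thesis by (simp add: q_def flip: sum_divide_distrib)
    qed
    ultimately show ?thesis using Npos by (simp add: N_def divide_simps)
  qed
  moreover have "(\<Sum>v\<in>V. (x v)\<^sup>2) = 1" using x by (simp add: S_def)
  ultimately show ?thesis using that unfolding q_def by blast
qed

text \<open>First-order optimality: for small \<open>t\<close> the linear term dominates, so a
  nonzero \<open>b\<close> makes the expression negative for one sign of \<open>t\<close>.\<close>

lemma affine_nonneg_square_zero: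
  fixes b c :: real
  assumes "\<And>t. 0 \<le> 2 * t * b + t\<^sup>2 * c"
  shows "b = 0"
proof (rule ccontr)
  assume b: "b \<noteq> 0"
  define d where "d = \<bar>c\<bar> + 1"
  have d: "d > 0" "c < d" by (auto simp: d_def)
  have "0 \<le> 2 * (- b / d) * b + (- b / d)\<^sup>2 * c" by (rule assms)
  also have "\<dots> = (b\<^sup>2 / d) * (c / d - 2)"
    using d by (simp add: field_simps power2_eq_square)
  finally have "c / d - 2 \<ge> 0"
    using b d by (simp add: zero_le_mult_iff divide_le_0_iff zero_le_divide_iff)
  then show False using d by (simp add: field_simps)
qed

text \<open>A maximizer of the Rayleigh quotient is stationary. Perturbing it along one coordinate
  vector at a time yields the eigenvector equation coordinate by coordinate.\<close>

lemma symmetric_eigenvector_of_positive_direction: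
  fixes a :: "'v \<Rightarrow> 'v \<Rightarrow> real"
  assumes fin: "finite V"
    and sym: "\<And>v w. v \<in> V \<Longrightarrow> w \<in> V \<Longrightarrow> a v w = a w v"
    and pos: "(\<Sum>v\<in>V. \<Sum>w\<in>V. a v w * y v * y w) > 0"
  obtains x \<mu> where "\<mu> > 0" "(\<Sum>v\<in>V. (x v)\<^sup>2) = 1"
    "\<And>v. v \<in> V \<Longrightarrow> (\<Sum>w\<in>V. a v w * x w) = \<mu> * x v"
proof -
  define q where "q = (\<lambda>x. \<Sum>v\<in>V. \<Sum>w\<in>V. a v w * x v * x w)"
  have "V \<noteq> {}" using pos by auto
  from rayleigh_maximizer[OF fin this, of a] obtain x
    where x1: "(\<Sum>v\<in>V. (x v)\<^sup>2) = 1" and mx: "\<And>y. q y \<le> q x * (\<Sum>v\<in>V. (y v)\<^sup>2)"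
    unfolding q_def by blast
  define \<mu> where "\<mu> = q x"
  have "0 < \<mu> * (\<Sum>v\<in>V. (y v)\<^sup>2)" using pos mx[of y] by (simp add: q_def \<mu>_def)
  moreover have "(\<Sum>v\<in>V. (y v)\<^sup>2) \<ge> 0" by (intro sum_nonneg) auto
  ultimately have mu: "\<mu> > 0" by (simp add: zero_less_mult_iff)
  have "(\<Sum>w\<in>V. a u w * x w) = \<mu> * x u" if u: "u \<in> V" for u
  proof -
    define e where "e = (\<lambda>v. if v = u then 1 else 0 :: real)"
    have ev: "(\<Sum>v\<in>V. e v * f v) = f u" for f
      using u fin by (simp add: e_def if_distrib[of "\<lambda>r. r * _"] cong: if_cong)
    have "0 \<le> 2 * t * (\<mu> * x u - (\<Sum>w\<in>V. a u w * x w)) + t\<^sup>2 * (\<mu> - a u u)" for t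
    proof -
      define z where "z = (\<lambda>v. x v + t * e v)"
      have nz: "(\<Sum>v\<in>V. (z v)\<^sup>2) = 1 + 2 * t * x u + t\<^sup>2"
      proof -
        have "(\<Sum>v\<in>V. (z v)\<^sup>2) = (\<Sum>v\<in>V. (x v)\<^sup>2 + e v * (2 * t * x v + t\<^sup>2 * e v))"
          by (intro sum.cong) (auto simp: z_def power2_eq_square algebra_simps)
        then show ?thesis by (simp add: sum.distrib ev x1) (simp add: e_def)
      qed
      have "q z = (\<Sum>v\<in>V. z v * (\<Sum>w\<in>V. a v w * z w))"
        by (simp add: q_def sum_distrib_left mult_ac)
      also have "\<dots> = (\<Sum>v\<in>V. z v * ((\<Sum>w\<in>V. a v w * x w) + t * a v u))"
      proof -
        have "(\<Sum>w\<in>V. a v w * z w) = (\<Sum>w\<in>V. a v w * x w + e w * (t * a v w))" for v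
          by (intro sum.cong refl) (simp add: z_def algebra_simps)
        then show ?thesis by (simp add: sum.distrib ev)
      qed
      also have "\<dots> = (\<Sum>v\<in>V. x v * (\<Sum>w\<in>V. a v w * x w) + t * a v u * x v
          + e v * (t * ((\<Sum>w\<in>V. a v w * x w) + t * a v u)))"
        by (intro sum.cong refl) (simp add: z_def algebra_simps)
      also have "\<dots> = q x + (\<Sum>v\<in>V. t * a v u * x v) + t * ((\<Sum>w\<in>V. a u w * x w) + t * a u u)"
        unfolding sum.distrib ev by (simp add: q_def sum_distrib_left mult_ac)
      also have "(\<Sum>v\<in>V. t * a v u * x v) = (\<Sum>w\<in>V. t * a u w * x w)"
        by (intro sum.cong refl) (simp add: sym u)
      also have "(\<Sum>w\<in>V. t * a u w * x w) = t * (\<Sum>w\<in>V. a u w * x w)"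
        by (simp add: sum_distrib_left mult.assoc)
      finally show ?thesis using mx[of z]
        unfolding nz \<mu>_def by (simp add: algebra_simps power2_eq_square)
    qed
    from affine_nonneg_square_zero[OF this] show ?thesis by simp
  qed
  with mu x1 show ?thesis using that by blast
qed

text \<open>A nonzero symmetric form takes a nonzero value somewhere. Depending on its sign, the
  case of a positive direction applies to \<open>a\<close> or to \<open>- a\<close>.\<close>

lemma symmetric_nonzero_eigenvector:
  fixes a :: "'v \<Rightarrow> 'v \<Rightarrow> real"
  assumes fin: "finite V"
    and sym: "\<And>v w. v \<in> V \<Longrightarrow> w \<in> V \<Longrightarrow> a v w = a w v"
    and nz: "v0 \<in> V" "w0 \<in> V" "a v0 w0 \<noteq> 0"
  obtains x \<mu> where "\<mu> \<noteq> 0" "(\<Sum>v\<in>V. (x v)\<^sup>2) = 1"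
    "\<And>v. v \<in> V \<Longrightarrow> (\<Sum>w\<in>V. a v w * x w) = \<mu> * x v"
proof -
  define q where "q = (\<lambda>x. \<Sum>v\<in>V. \<Sum>w\<in>V. a v w * x v * x w)"
  define e where "e = (\<lambda>(u::'v) v. if v = u then 1 else 0 :: real)"
  have ev: "(\<Sum>v\<in>V. e u v * f v) = f u" "(\<Sum>v\<in>V. f v * e u v) = f u" if "u \<in> V" for f u
    using that fin by (simp_all add: e_def if_distrib[of "\<lambda>r. r * _"] if_distrib[of "\<lambda>r. _ * r"] cong: if_cong)
  define y where "y = (\<lambda>s v. e v0 v + s * e w0 v)"
  have "q (y s) = a v0 v0 + 2 * s * a v0 w0 + s\<^sup>2 * a w0 w0" for s
  proof -
    have "q (y s) = (\<Sum>v\<in>V. y s v * (\<Sum>w\<in>V. a v w * y s w))"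
      by (simp add: q_def sum_distrib_left mult_ac)
    also have "\<dots> = (\<Sum>v\<in>V. y s v * (a v v0 + s * a v w0))"
      by (intro sum.cong refl)
        (simp add: y_def distrib_left sum.distrib ev nz mult.left_commute flip: sum_distrib_left)
    also have "\<dots> = (a v0 v0 + s * a v0 w0) + s * (a w0 v0 + s * a w0 w0)"
      by (simp add: y_def distrib_right sum.distrib ev nz mult.assoc flip: sum_distrib_left)
    finally show ?thesis by (simp add: sym[of w0 v0] nz power2_eq_square algebra_simps)
  qed
  \<comment> \<open>Polarization; it remains right when \<open>v0 = w0\<close>, where
    \<open>y (-1)\<close> is zero.\<close>
  then have "q (y 1) - q (y (-1)) = 4 * a v0 w0" by simp
  with nz(3) have "q (y 1) \<noteq> 0 \<or> q (y (-1)) \<noteq> 0" by auto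
  then obtain z where "q z \<noteq> 0" by blast
  then consider "q z > 0" | "q z < 0" by linarith
  then show ?thesis
  proof cases
    case 1
    from symmetric_eigenvector_of_positive_direction[OF fin sym this[unfolded q_def]] obtain x \<mu>
      where "\<mu> > 0" "(\<Sum>v\<in>V. (x v)\<^sup>2) = 1"
        "\<And>v. v \<in> V \<Longrightarrow> (\<Sum>w\<in>V. a v w * x w) = \<mu> * x v" by blast
    then show ?thesis using that[of \<mu> x] by simp
  next
    case 2
    then have p: "(\<Sum>v\<in>V. \<Sum>w\<in>V. (- a v w) * z v * z w) > 0" by (simp add: q_def sum_negf)
    have "\<And>v w. v \<in> V \<Longrightarrow> w \<in> V \<Longrightarrow> - a v w = - a w v" by (simp add: sym)
    from symmetric_eigenvector_of_positive_direction[OF fin this p] obtain x \<mu>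
      where "\<mu> > 0" "(\<Sum>v\<in>V. (x v)\<^sup>2) = 1"
        and *: "\<And>v. v \<in> V \<Longrightarrow> (\<Sum>w\<in>V. - a v w * x w) = \<mu> * x v" by blast
    moreover have "(\<Sum>w\<in>V. a v w * x w) = (- \<mu>) * x v" if "v \<in> V" for v
      using *[OF that] by (simp add: sum_negf)
    ultimately show ?thesis using that[of "- \<mu>" x] by auto
  qed
qed

section \<open>Orthonormal families and the spectral decomposition\<close>

definition orthonormal_family :: "'v set \<Rightarrow> nat \<Rightarrow> (nat \<Rightarrow> 'v \<Rightarrow> real) \<Rightarrow> bool" where
  "orthonormal_family V m u \<longleftrightarrow>
    (\<forall>l<m. \<forall>l'<m. (\<Sum>v\<in>V. u l v * u l' v) = (if l = l' then 1 else 0))"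

lemma orthonormal_familyD:
  "orthonormal_family V m u \<Longrightarrow> l < m \<Longrightarrow> l' < m \<Longrightarrow>
    (\<Sum>v\<in>V. u l v * u l' v) = (if l = l' then 1 else 0)"
  by (simp add: orthonormal_family_def)

text \<open>The squared distance between \<open>x\<close> and its projection onto the span of the
  family is nonnegative; expand it.\<close>

lemma bessel:
  assumes on: "orthonormal_family V m u"
  shows "(\<Sum>l<m. (\<Sum>v\<in>V. u l v * x v)\<^sup>2) \<le> (\<Sum>v\<in>V. (x v)\<^sup>2)"
proof -
  define p where "p = (\<lambda>l. \<Sum>v\<in>V. u l v * x v)"
  have s1: "(\<Sum>v\<in>V. x v * (\<Sum>l<m. p l * u l v)) = (\<Sum>l<m. (p l)\<^sup>2)"
  proof -
    have "(\<Sum>v\<in>V. x v * (\<Sum>l<m. p l * u l v)) = (\<Sum>l<m. \<Sum>v\<in>V. x v * (p l * u l v))"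
      unfolding sum_distrib_left by (rule sum.swap)
    also have "\<dots> = (\<Sum>l<m. p l * p l)"
      by (simp add: p_def sum_distrib_left mult_ac)
    finally show ?thesis by (simp add: power2_eq_square)
  qed
  have s2: "(\<Sum>v\<in>V. (\<Sum>l<m. p l * u l v)\<^sup>2) = (\<Sum>l<m. (p l)\<^sup>2)"
  proof -
    have "(\<Sum>v\<in>V. (\<Sum>l<m. p l * u l v)\<^sup>2)
        = (\<Sum>v\<in>V. \<Sum>l<m. \<Sum>l'<m. p l * p l' * (u l v * u l' v))"
      by (simp add: power2_eq_square sum_product mult_ac)
    also have "\<dots> = (\<Sum>l<m. \<Sum>v\<in>V. \<Sum>l'<m. p l * p l' * (u l v * u l' v))"
      by (rule sum.swap)
    also have "\<dots> = (\<Sum>l<m. \<Sum>l'<m. p l * p l' * (\<Sum>v\<in>V. u l v * u l' v))"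
      by (intro sum.cong refl, subst sum.swap) (simp add: sum_distrib_left)
    also have "\<dots> = (\<Sum>l<m. \<Sum>l'<m. if l' = l then p l * p l' else 0)"
      by (intro sum.cong refl) (simp add: orthonormal_familyD[OF on])
    also have "\<dots> = (\<Sum>l<m. (p l)\<^sup>2)" by (simp add: power2_eq_square)
    finally show ?thesis .
  qed
  have "0 \<le> (\<Sum>v\<in>V. (x v - (\<Sum>l<m. p l * u l v))\<^sup>2)" by (intro sum_nonneg) auto
  also have "\<dots> = (\<Sum>v\<in>V. (x v)\<^sup>2) - 2 * (\<Sum>v\<in>V. x v * (\<Sum>l<m. p l * u l v))
      + (\<Sum>v\<in>V. (\<Sum>l<m. p l * u l v)\<^sup>2)"
    by (simp add: power2_diff sum.distrib sum_subtractf sum_distrib_left mult.assoc)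
  finally show ?thesis using s1 s2 by (simp add: p_def)
qed

text \<open>Bessel for a coordinate vector bounds the squares at one vertex, summed over the family,
  by 1; summing over \<open>V\<close> counts the members. This bound makes a maximal family
  exist.\<close>

lemma orthonormal_family_le_card:
  assumes fin: "finite V" and on: "orthonormal_family V m u"
  shows "m \<le> card V"
proof -
  have "real m = (\<Sum>l<m. \<Sum>v\<in>V. u l v * u l v)"
    using orthonormal_familyD[OF on] by simp
  also have "\<dots> = (\<Sum>v\<in>V. \<Sum>l<m. (u l v)\<^sup>2)"
    unfolding power2_eq_square by (rule sum.swap)
  also have "\<dots> \<le> (\<Sum>v\<in>V. 1)"
  proof (rule sum_mono)
    fix v assume v: "v \<in> V"
    have d: "(\<Sum>w\<in>V. f w * (if w = v then 1 else 0)) = f v"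
      "(\<Sum>w\<in>V. (if w = v then 1 else 0)\<^sup>2) = (1::real)" for f :: "'a \<Rightarrow> real"
      using v fin by (simp_all add: if_distrib[of "\<lambda>r. _ * r"] if_distrib[of "\<lambda>r. r\<^sup>2"] cong: if_cong)
    show "(\<Sum>l<m. (u l v)\<^sup>2) \<le> 1"
      using bessel[OF on, of "\<lambda>w. if w = v then 1 else 0"] by (simp add: d)
  qed
  finally show ?thesis by simp
qed

text \<open>The family may be shorter than \<open>card V\<close>: only nonzero eigenvalues are collected, by taking a
  maximal orthonormal family of eigenvectors and deflating; a further eigenvector of the deflated
  form would extend the family.\<close>

theorem symmetric_spectral_decomposition:
  fixes a :: "'v \<Rightarrow> 'v \<Rightarrow> real"
  assumes fin: "finite V"
    and sym: "\<And>v w. v \<in> V \<Longrightarrow> w \<in> V \<Longrightarrow> a v w = a w v"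
  obtains m u \<nu> where "orthonormal_family V m u"
    and "\<And>v w. v \<in> V \<Longrightarrow> w \<in> V \<Longrightarrow> a v w = (\<Sum>l<m. \<nu> l * u l v * u l w)"
proof -
  define F where "F = (\<lambda>m. \<exists>u \<nu>. orthonormal_family V m u \<and>
    (\<forall>l<m. \<forall>v\<in>V. (\<Sum>w\<in>V. a v w * u l w) = \<nu> l * u l v))"
  have "F 0" by (simp add: F_def orthonormal_family_def)
  moreover have bound: "\<forall>m. F m \<longrightarrow> m \<le> card V"
    using orthonormal_family_le_card[OF fin] by (auto simp: F_def)
  ultimately obtain m where Fm: "F m" and mx: "\<And>m'. F m' \<Longrightarrow> m' \<le> m"
    using Nat.ex_has_greatest_nat[of F 0 "card V"] by blast
  from Fm obtain u \<nu> where on: "orthonormal_family V m u"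
    and ev: "\<And>l v. l < m \<Longrightarrow> v \<in> V \<Longrightarrow> (\<Sum>w\<in>V. a v w * u l w) = \<nu> l * u l v"
    unfolding F_def by blast
  define b where "b = (\<lambda>v w. a v w - (\<Sum>l<m. \<nu> l * u l v * u l w))"
  have bsym: "b v w = b w v" if "v \<in> V" "w \<in> V" for v w
    unfolding b_def by (simp add: sym that mult_ac)
  have bx: "(\<Sum>w\<in>V. b v w * x w)
      = (\<Sum>w\<in>V. a v w * x w) - (\<Sum>l<m. \<nu> l * u l v * (\<Sum>w\<in>V. u l w * x w))" for v x
  proof -
    have "(\<Sum>w\<in>V. (\<Sum>l<m. \<nu> l * u l v * u l w) * x w)
        = (\<Sum>l<m. \<nu> l * u l v * (\<Sum>w\<in>V. u l w * x w))"
      unfolding sum_distrib_right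
      by (subst sum.swap) (simp add: sum_distrib_left mult_ac)
    then show ?thesis by (simp add: b_def left_diff_distrib sum_subtractf)
  qed
  have "b v w = 0" if "v \<in> V" "w \<in> V" for v w
  proof (rule ccontr)
    assume nz: "b v w \<noteq> 0"
    from symmetric_nonzero_eigenvector[OF fin bsym that nz] obtain x \<mu> where mu: "\<mu> \<noteq> 0"
      and x1: "(\<Sum>v\<in>V. (x v)\<^sup>2) = 1" and xe: "\<And>v. v \<in> V \<Longrightarrow> (\<Sum>w\<in>V. b v w * x w) = \<mu> * x v"
      by blast
    have bu: "(\<Sum>w\<in>V. b v w * u l w) = 0" if "l < m" "v \<in> V" for l v
    proof -
      have "(\<Sum>l'<m. \<nu> l' * u l' v * (\<Sum>w\<in>V. u l' w * u l w))
          = (\<Sum>l'<m. if l' = l then \<nu> l' * u l' v else 0)"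
        by (intro sum.cong refl) (simp add: orthonormal_familyD[OF on] that)
      then show ?thesis using that by (simp add: bx ev)
    qed
    \<comment> \<open>Symmetry moves \<open>b\<close> onto \<open>u l\<close>, which it annihilates.
      As \<open>\<mu>\<close> is nonzero, \<open>x\<close> is orthogonal to the old family, and on
      such a vector \<open>b\<close> and \<open>a\<close> agree.\<close>
    have orth: "(\<Sum>v\<in>V. u l v * x v) = 0" if l: "l < m" for l
    proof -
      have "\<mu> * (\<Sum>v\<in>V. u l v * x v) = (\<Sum>v\<in>V. u l v * (\<mu> * x v))"
        by (simp add: sum_distrib_left mult_ac)
      also have "\<dots> = (\<Sum>v\<in>V. u l v * (\<Sum>w\<in>V. b v w * x w))"
        by (simp add: xe)
      also have "\<dots> = (\<Sum>w\<in>V. \<Sum>v\<in>V. u l v * (b v w * x w))"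
        unfolding sum_distrib_left by (rule sum.swap)
      also have "\<dots> = (\<Sum>w\<in>V. x w * (\<Sum>v\<in>V. b w v * u l v))"
        unfolding sum_distrib_left by (intro sum.cong refl) (simp add: bsym mult_ac)
      also have "\<dots> = 0" by (simp add: bu l)
      finally show ?thesis using mu by simp
    qed
    define u' \<nu>' where "u' = u(m := x)" and "\<nu>' = \<nu>(m := \<mu>)"
    have "orthonormal_family V (Suc m) u'"
      using on orth x1 unfolding orthonormal_family_def u'_def
      by (auto simp: less_Suc_eq power2_eq_square mult.commute)
    moreover have "(\<Sum>w\<in>V. a v w * u' l w) = \<nu>' l * u' l v" if "l < Suc m" "v \<in> V" for l v
    proof (cases "l = m")
      case True
      then show ?thesis using xe[OF that(2)] bx[of v x] orth by (simp add: u'_def \<nu>'_def)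
    next
      case False
      then show ?thesis using that ev by (simp add: u'_def \<nu>'_def)
    qed
    ultimately have "F (Suc m)" unfolding F_def by blast
    with mx[of "Suc m"] show False by simp
  qed
  with on show ?thesis using that[of m u \<nu>] by (simp add: b_def)
qed

section \<open>Power sums\<close>

text \<open>The expression is, up to a factor \<open>n\<close>, the convexity defect of \<open>t \<mapsto> t powr ((n + 1) / n)\<close> between the
  points \<open>u ^ n\<close> and \<open>v ^ n\<close>, cleared of the irrational exponent.\<close>

lemma young_gap_nonneg:
  fixes u v :: real
  assumes "0 \<le> u" "0 \<le> v"
  shows "0 \<le> real n * u ^ Suc n - real (Suc n) * v * u ^ n + v ^ Suc n"
    and "n \<ge> 1 \<Longrightarrow> u \<noteq> v \<Longrightarrow> 0 < real n * u ^ Suc n - real (Suc n) * v * u ^ n + v ^ Suc n"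
proof -
  define D where "D = (\<lambda>n. real n * u ^ Suc n - real (Suc n) * v * u ^ n + v ^ Suc n)"
  \<comment> \<open>Induction on the exponent: \<open>D 0 = 0\<close>, and each increment is a
    product of two factors of equal sign.\<close>
  have step: "D (Suc n) = u * D n + (u - v) * (u ^ Suc n - v ^ Suc n)" for n
    by (simp add: D_def algebra_simps)
  have cmp: "0 \<le> (u - v) * (u ^ Suc n - v ^ Suc n)" for n
  proof (cases "u \<le> v")
    case True
    then have "u ^ Suc n \<le> v ^ Suc n" using assms by (intro power_mono)
    then show ?thesis using True by (intro mult_nonpos_nonpos) auto
  next
    case False
    then have "v ^ Suc n \<le> u ^ Suc n" using assms by (intro power_mono) auto
    then show ?thesis using False by (intro mult_nonneg_nonneg) auto
  qed
  have nonneg: "0 \<le> D n" for n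
  proof (induction n)
    case (Suc n)
    then show ?case unfolding step using cmp[of n] assms by simp
  qed (simp add: D_def)
  then show "0 \<le> real n * u ^ Suc n - real (Suc n) * v * u ^ n + v ^ Suc n" by (simp add: D_def)
  have "0 < D n" if n: "n \<ge> 1" and ne: "u \<noteq> v"
  proof -
    obtain p where p: "n = Suc p" using n by (cases n) auto
    have "0 < (u - v) * (u ^ Suc p - v ^ Suc p)"
    proof (cases "u < v")
      case True
      then show ?thesis
        using power_strict_mono[OF True assms(1), of "Suc p"] by (intro mult_neg_neg) auto
    next
      case False
      then have "v < u" using ne by simp
      then show ?thesis
        using power_strict_mono[OF _ assms(2), of u "Suc p"] by (intro mult_pos_pos) auto
    qed
    then show ?thesis using nonneg[of p] assms unfolding p step by (simp add: add_nonneg_pos)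
  qed
  then show "n \<ge> 1 \<Longrightarrow> u \<noteq> v \<Longrightarrow>
      0 < real n * u ^ Suc n - real (Suc n) * v * u ^ n + v ^ Suc n" by (simp add: D_def)
qed

text \<open>A majorization argument. The sum of the two gaps is nonnegative and vanishes only if
  both pairs agree, yet summation by parts writes it as a combination of the hypotheses that is at
  most zero.\<close>

lemma two_power_sums_rigid:
  fixes a c x y :: real
  assumes n: "n \<ge> 1" and nn: "0 \<le> y" "0 \<le> c" and ord: "y \<le> x" "x \<le> a"
    and le: "x ^ n + y ^ n \<le> a ^ n + c ^ n"
    and ge: "a ^ Suc n + c ^ Suc n \<le> x ^ Suc n + y ^ Suc n"
  shows "x = a \<and> y = c"
proof (rule ccontr)
  assume neq: "\<not> (x = a \<and> y = c)"
  let ?Y = "\<lambda>u v. real n * u ^ Suc n - real (Suc n) * v * u ^ n + v ^ Suc n"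
  have x0: "0 \<le> x" "0 \<le> a" using nn ord by linarith+
  have y1: "0 \<le> ?Y a x" and y2: "0 \<le> ?Y c y"
    using young_gap_nonneg(1) x0 nn by blast+
  have "0 < ?Y a x + ?Y c y"
  proof (cases "x = a")
    case False
    then have "0 < ?Y a x" using young_gap_nonneg(2)[OF x0(2) x0(1) n] by metis
    then show ?thesis using y2 by linarith
  next
    case True
    then have "0 < ?Y c y" using young_gap_nonneg(2)[OF nn(2) nn(1) n] neq by metis
    then show ?thesis using y1 by linarith
  qed
  also have "?Y a x + ?Y c y = real n * (a ^ Suc n + c ^ Suc n - (x ^ Suc n + y ^ Suc n))
      - real (Suc n) * ((x - y) * (a ^ n - x ^ n) + y * (a ^ n + c ^ n - (x ^ n + y ^ n)))"
    by (simp add: algebra_simps)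
  also have "\<dots> \<le> 0 - 0"
  proof (rule diff_mono)
    show "real n * (a ^ Suc n + c ^ Suc n - (x ^ Suc n + y ^ Suc n)) \<le> 0"
      using ge by (intro mult_nonneg_nonpos) auto
    have "0 \<le> (x - y) * (a ^ n - x ^ n)"
      using ord x0 by (intro mult_nonneg_nonneg) (auto intro: power_mono)
    moreover have "0 \<le> y * (a ^ n + c ^ n - (x ^ n + y ^ n))"
      using nn le by (intro mult_nonneg_nonneg) auto
    ultimately show "0 \<le> real (Suc n)
        * ((x - y) * (a ^ n - x ^ n) + y * (a ^ n + c ^ n - (x ^ n + y ^ n)))"
      by (intro mult_nonneg_nonneg[OF of_nat_0_le_iff] add_nonneg_nonneg)
  qed
  finally show False by simp
qed

text \<open>Reduction to two numbers: the largest \<open>\<beta> j\<close> and the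
  \<open>n\<close>-norm \<open>y\<close> of the others. The next norm is no larger, so the
  hypotheses survive, and equality leaves a single element in the rest.\<close>

lemma power_sums_rigid:
  fixes \<beta> :: "'i \<Rightarrow> real"
  assumes n: "n \<ge> 1" and fin: "finite N" and pos: "\<And>j. j \<in> N \<Longrightarrow> 0 < \<beta> j"
    and bnd: "\<And>j. j \<in> N \<Longrightarrow> \<beta> j \<le> a" and c: "0 < c" "c \<le> a"
    and le: "(\<Sum>j\<in>N. \<beta> j ^ n) \<le> a ^ n + c ^ n"
    and ge: "a ^ Suc n + c ^ Suc n \<le> (\<Sum>j\<in>N. \<beta> j ^ Suc n)"
  shows "(\<Sum>j\<in>N. \<beta> j ^ q) = a ^ q + c ^ q"
proof -
  have apos: "0 < a" using c by simp
  have "0 < a ^ Suc n + c ^ Suc n" using apos c by (intro add_pos_pos zero_less_power)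
  with ge have "N \<noteq> {}" by force
  then have "Max (\<beta> ` N) \<in> \<beta> ` N" using fin by simp
  then obtain j where j: "j \<in> N" and mj: "\<beta> j = Max (\<beta> ` N)" by force
  have mx: "\<beta> i \<le> \<beta> j" if "i \<in> N" for i using that fin by (simp add: mj)
  define x R where "x = \<beta> j" and "R = N - {j}"
  have split: "(\<Sum>i\<in>N. \<beta> i ^ p) = x ^ p + (\<Sum>i\<in>R. \<beta> i ^ p)" for p
    using fin j by (simp add: x_def R_def sum.remove)
  have x0: "0 < x" using pos[OF j] by (simp add: x_def)
  \<comment> \<open>A maximum below \<open>c\<close> would make the sum of the next powers too
    small. With \<open>c \<le> x\<close>, at most \<open>a ^ n\<close> is left for the rest, hence
    \<open>y \<le> a\<close>.\<close>
  have xc: "c \<le> x"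
  proof (rule ccontr)
    assume "\<not> c \<le> x"
    have "(\<Sum>i\<in>N. \<beta> i ^ Suc n) \<le> (\<Sum>i\<in>N. x * \<beta> i ^ n)"
      using mx pos by (auto intro!: sum_mono mult_right_mono simp: x_def less_imp_le)
    also have "\<dots> \<le> x * (a ^ n + c ^ n)"
      using le x0 by (simp flip: sum_distrib_left)
    also have "\<dots> < a * a ^ n + c * c ^ n"
      unfolding distrib_left using \<open>\<not> c \<le> x\<close> c apos
      by (intro add_strict_mono mult_strict_right_mono) auto
    finally show False using ge by simp
  qed
  define y where "y = root n (\<Sum>i\<in>R. \<beta> i ^ n)"
  have nnR: "0 \<le> (\<Sum>i\<in>R. \<beta> i ^ n)" using pos by (intro sum_nonneg) (auto simp: R_def less_imp_le)
  have y: "0 \<le> y" "y ^ n = (\<Sum>i\<in>R. \<beta> i ^ n)"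
    using nnR n by (simp_all add: y_def real_root_pow_pos2)
  have by': "\<beta> i \<le> y" if "i \<in> R" for i
  proof -
    have "\<beta> i ^ n \<le> y ^ n"
      unfolding y using that fin pos by (intro member_le_sum) (auto simp: R_def less_imp_le)
    then show ?thesis using power_mono_iff[of "\<beta> i" y n] n y pos that
      by (auto simp: R_def less_imp_le)
  qed
  have ya: "y \<le> a"
  proof -
    have "y ^ n \<le> a ^ n" using le split[of n] power_mono[OF xc, of n] c y by linarith
    then show ?thesis using power_mono_iff[of y a n] n y apos by auto
  qed
  have xa: "x \<le> a" using bnd[OF j] by (simp add: x_def)
  have gap: "(\<Sum>i\<in>R. \<beta> i ^ Suc n) \<le> y ^ Suc n"
  proof -
    have "(\<Sum>i\<in>R. \<beta> i ^ Suc n) \<le> (\<Sum>i\<in>R. y * \<beta> i ^ n)"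
      using by' pos by (auto intro!: sum_mono mult_right_mono simp: R_def less_imp_le)
    then show ?thesis using y by (simp flip: sum_distrib_left)
  qed
  have le': "x ^ n + y ^ n \<le> a ^ n + c ^ n" using le split y by simp
  have ge': "a ^ Suc n + c ^ Suc n \<le> x ^ Suc n + y ^ Suc n" using ge gap split[of "Suc n"] by linarith
  \<comment> \<open>The rest may outweigh the largest single value; then \<open>x\<close> and
    \<open>y\<close> exchange roles.\<close>
  have xy: "x = a \<and> y = c \<or> y = a \<and> x = c"
  proof (cases "y \<le> x")
    case True
    then show ?thesis using two_power_sums_rigid[OF n y(1) _ True xa le' ge'] c by auto
  next
    case False
    then show ?thesis using two_power_sums_rigid[of n x c y a] n x0 c ya le' ge'
      by (auto simp: add.commute)
  qed
  then have tot: "x ^ p + y ^ p = a ^ p + c ^ p" for p by auto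
  have y0: "0 < y" using xy c apos by auto
  have "(\<Sum>i\<in>R. \<beta> i ^ Suc n) = y ^ Suc n"
    using gap ge split[of "Suc n"] tot[of "Suc n"] by linarith
  then have "(\<Sum>i\<in>R. (y - \<beta> i) * \<beta> i ^ n) = 0"
    using y by (simp add: left_diff_distrib sum_subtractf flip: sum_distrib_left)
  moreover have "\<forall>i\<in>R. 0 \<le> (y - \<beta> i) * \<beta> i ^ n"
    using by' pos by (auto intro!: mult_nonneg_nonneg simp: R_def less_imp_le)
  moreover have "finite R" using fin by (simp add: R_def)
  ultimately have "\<forall>i\<in>R. (y - \<beta> i) * \<beta> i ^ n = 0" by (subst (asm) sum_nonneg_eq_0_iff) auto
  then have eq: "\<beta> i = y" if "i \<in> R" for i
    using that pos[of i] by (auto simp: R_def)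
  then have "y ^ n = real (card R) * y ^ n" using y by simp
  then have "card R = 1" using y0 by simp
  then have "(\<Sum>i\<in>R. \<beta> i ^ q) = y ^ q" using eq by simp
  then show ?thesis using split tot by simp
qed

text \<open>The negative \<open>\<nu> l\<close> balance the positive ones in the odd power sum, yet none exceeds \<open>\<nu> i\<close> in modulus.
  Equality makes the nonzero values symmetric about \<open>0\<close>, so that all odd power sums vanish.\<close>

lemma even_power_sum_ge_if_odd_power_sum_zero:
  fixes \<nu> :: "'i \<Rightarrow> real"
  assumes fin: "finite I" and n: "even n" "n \<ge> 1" and c: "0 < c" and ij: "i \<in> I" "j \<in> I" "i \<noteq> j"
    and bnd: "\<And>l. l \<in> I \<Longrightarrow> \<bar>\<nu> l\<bar> \<le> \<nu> i" and cj: "c \<le> \<nu> j"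
    and odd0: "(\<Sum>l\<in>I. \<nu> l ^ Suc n) = 0"
  shows "2 * (\<nu> i ^ n + c ^ n) \<le> (\<Sum>l\<in>I. \<nu> l ^ n)"
    and "(\<Sum>l\<in>I. \<nu> l ^ n) = 2 * (\<nu> i ^ n + c ^ n) \<Longrightarrow> odd q \<Longrightarrow> (\<Sum>l\<in>I. \<nu> l ^ q) = 0"
proof -
  define a where "a = \<nu> i"
  define P N where "P = {l \<in> I. \<nu> l > 0}" and "N = {l \<in> I. \<nu> l < 0}"
  define R where "R = P - {i, j}"
  have ca: "c \<le> a" using bnd[OF ij(2)] cj by (simp add: a_def)
  have finPN: "finite P" "finite N" "finite R" using fin by (auto simp: P_def N_def R_def)
  have total: "(\<Sum>l\<in>I. \<nu> l ^ p) = (\<Sum>l\<in>P. \<nu> l ^ p) + (-1) ^ p * (\<Sum>l\<in>N. (- \<nu> l) ^ p)"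
    if "p \<ge> 1" for p
  proof -
    have "(\<Sum>l\<in>I. \<nu> l ^ p) = (\<Sum>l\<in>P \<union> N. \<nu> l ^ p)"
      using fin that by (intro sum.mono_neutral_right) (auto simp: P_def N_def not_less)
    also have "\<dots> = (\<Sum>l\<in>P. \<nu> l ^ p) + (\<Sum>l\<in>N. \<nu> l ^ p)"
      using finPN by (intro sum.union_disjoint) (auto simp: P_def N_def)
    also have "(\<Sum>l\<in>N. \<nu> l ^ p) = (-1) ^ p * (\<Sum>l\<in>N. (- \<nu> l) ^ p)"
      by (simp add: sum_distrib_left flip: power_mult_distrib)
    finally show ?thesis .
  qed
  have ijP: "i \<in> P" "j \<in> P" using ij c ca cj by (auto simp: P_def a_def)
  have Psplit: "(\<Sum>l\<in>P. \<nu> l ^ p) = a ^ p + \<nu> j ^ p + (\<Sum>l\<in>R. \<nu> l ^ p)" for p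
  proof -
    have "(\<Sum>l\<in>insert i (insert j R). \<nu> l ^ p) = a ^ p + \<nu> j ^ p + (\<Sum>l\<in>R. \<nu> l ^ p)"
      using finPN(3) ij(3) by (subst sum.insert; simp add: a_def R_def)+
    moreover have "insert i (insert j R) = P" using ijP by (auto simp: R_def)
    ultimately show ?thesis by simp
  qed
  have Rnn: "0 \<le> (\<Sum>l\<in>R. \<nu> l ^ p)" for p
    by (intro sum_nonneg) (auto simp: R_def P_def)
  have Pge: "a ^ p + c ^ p \<le> (\<Sum>l\<in>P. \<nu> l ^ p)" for p
    unfolding Psplit using power_mono[OF cj, of p] c Rnn[of p] by simp
  \<comment> \<open>Assuming only a weak upper bound serves both claims: a violation of the
    inequality would be turned into equality, and under equality the odd sums vanish.\<close>
  have key: "(\<Sum>l\<in>I. \<nu> l ^ n) = 2 * (a ^ n + c ^ n) \<and> (\<forall>q. odd q \<longrightarrow> (\<Sum>l\<in>I. \<nu> l ^ q) = 0)"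
    if small: "(\<Sum>l\<in>I. \<nu> l ^ n) \<le> 2 * (a ^ n + c ^ n)"
  proof -
    have Nle: "(\<Sum>l\<in>N. (- \<nu> l) ^ n) \<le> a ^ n + c ^ n"
      using small total[OF n(2)] Pge[of n] n(1) by simp
    have Nge: "a ^ Suc n + c ^ Suc n \<le> (\<Sum>l\<in>N. (- \<nu> l) ^ Suc n)"
      using odd0 total[of "Suc n"] Pge[of "Suc n"] n(1) by simp
    have Nb: "- \<nu> l \<le> a" if "l \<in> N" for l using bnd[of l] that by (auto simp: N_def a_def)
    have Neq: "(\<Sum>l\<in>N. (- \<nu> l) ^ q) = a ^ q + c ^ q" for q
      by (rule power_sums_rigid[OF n(2) finPN(2) _ Nb c ca Nle Nge]) (auto simp: N_def)
    have eqn: "(\<Sum>l\<in>P. \<nu> l ^ n) = a ^ n + c ^ n"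
      using small total[OF n(2)] Pge[of n] n(1) Neq[of n] by simp
    have jc: "\<nu> j ^ n = c ^ n" and R0: "(\<Sum>l\<in>R. \<nu> l ^ n) = 0"
      using eqn Psplit[of n] Rnn[of n] power_mono[OF cj, of n] c by auto
    have j: "\<nu> j = c" using jc cj c n power_eq_iff_eq_base[of n "\<nu> j" c] by auto
    have "R = {}"
    proof (rule ccontr)
      assume "R \<noteq> {}"
      then have "0 < (\<Sum>l\<in>R. \<nu> l ^ n)"
        using finPN by (intro sum_pos) (auto simp: R_def P_def)
      then show False using R0 by simp
    qed
    then have Peq: "(\<Sum>l\<in>P. \<nu> l ^ q) = a ^ q + c ^ q" for q by (simp add: Psplit j)
    have "(\<Sum>l\<in>I. \<nu> l ^ q) = 0" if "odd q" for q
      using total[of q] that Peq[of q] Neq[of q] by (cases q) auto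
    moreover have "(\<Sum>l\<in>I. \<nu> l ^ n) = 2 * (a ^ n + c ^ n)"
      using total[OF n(2)] eqn Neq[of n] n(1) by simp
    ultimately show ?thesis by blast
  qed
  show "2 * (\<nu> i ^ n + c ^ n) \<le> (\<Sum>l\<in>I. \<nu> l ^ n)"
    using key unfolding a_def by linarith
  show "(\<Sum>l\<in>I. \<nu> l ^ n) = 2 * (\<nu> i ^ n + c ^ n) \<Longrightarrow> odd q \<Longrightarrow> (\<Sum>l\<in>I. \<nu> l ^ q) = 0"
    using key unfolding a_def by simp
qed

section \<open>Walks and test vectors in a finite graph\<close>

text \<open>The recurrence that makes sines eigenvectors of a path.\<close>

lemma sin_three_term:
  "sin (real i * \<phi>) + sin (real (i + 2) * \<phi>) = 2 * cos \<phi> * sin (real (i + 1) * \<phi>)"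
proof -
  define t where "t = real (i + 1) * \<phi>"
  have *: "real i * \<phi> = t - \<phi>" "real (i + 2) * \<phi> = t + \<phi>" by (auto simp: t_def algebra_simps)
  show ?thesis unfolding * t_def[symmetric] by (simp add: sin_add sin_diff)
qed

text \<open>Graphs as plain relations, so that the existence of a walk is membership in
  \<open>E ^^ n\<close>. Library digraphs and matrices are connected to it only at the end.\<close>

locale edge_relation =
  fixes V :: "'v set" and E :: "'v rel"
  assumes fin: "finite V" and sub: "E \<subseteq> V \<times> V" and symE: "sym E" and irreflE: "irrefl E"
begin

definition adj :: "'v \<Rightarrow> 'v \<Rightarrow> real" where
  "adj u v = of_bool ((u, v) \<in> E)"

primrec walks :: "nat \<Rightarrow> 'v \<Rightarrow> 'v \<Rightarrow> real" where
  "walks 0 u v = of_bool (u = v)"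
| "walks (Suc n) u v = (\<Sum>w\<in>V. walks n u w * adj w v)"

lemma adj_sym: "adj u v = adj v u"
  using symE by (auto simp: adj_def sym_def)

lemma adj_nonneg [simp]: "0 \<le> adj u v"
  by (simp add: adj_def)

lemma edge_sym: "(u, v) \<in> E \<Longrightarrow> (v, u) \<in> E"
  using symE by (auto dest: symD)

lemma edge_in: "(u, v) \<in> E \<Longrightarrow> u \<in> V" "(u, v) \<in> E \<Longrightarrow> v \<in> V"
  using sub by auto

lemma no_loop [simp]: "(v, v) \<notin> E"
  using irreflE by (auto simp: irrefl_def)

lemma finE: "finite E"
  using fin sub finite_subset by blast

lemma walks_nonneg [simp]: "0 \<le> walks n u v"
  by (induction n arbitrary: v) (auto intro!: sum_nonneg)

lemma walks_pos_iff: "u \<in> V \<Longrightarrow> 0 < walks n u v \<longleftrightarrow> (u, v) \<in> E ^^ n"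
proof (induction n arbitrary: v)
  case (Suc n)
  have "0 < walks (Suc n) u v \<longleftrightarrow> (\<exists>w\<in>V. walks n u w * adj w v \<noteq> 0)"
    using fin by (simp add: sum_nonneg_eq_0_iff less_le sum_nonneg eq_commute[of 0])
  also have "\<dots> \<longleftrightarrow> (\<exists>w\<in>V. 0 < walks n u w \<and> (w, v) \<in> E)"
    by (auto simp: adj_def less_le)
  also have "\<dots> \<longleftrightarrow> (u, v) \<in> E ^^ Suc n"
    using Suc edge_in by auto
  finally show ?case .
qed simp

lemma relpow_sym: "(u, v) \<in> E ^^ n \<Longrightarrow> (v, u) \<in> E ^^ n"
proof (induction n arbitrary: v)
  case (Suc n)
  then obtain w where "(u, w) \<in> E ^^ n" "(w, v) \<in> E" by auto
  then show ?case using Suc.IH edge_sym by (blast intro: relpow_Suc_I2)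
qed simp

lemma relpow_trans: "(u, v) \<in> E ^^ m \<Longrightarrow> (v, w) \<in> E ^^ n \<Longrightarrow> (u, w) \<in> E ^^ (m + n)"
  by (auto simp: relpow_add)

definition quad :: "('v \<Rightarrow> real) \<Rightarrow> real" where
  "quad x = (\<Sum>v\<in>V. \<Sum>w\<in>V. adj v w * x v * x w)"

definition nsq :: "('v \<Rightarrow> real) \<Rightarrow> real" where
  "nsq x = (\<Sum>v\<in>V. (x v)\<^sup>2)"

text \<open>A certificate, with an inequality in place of the eigenvector equation, that the
  subgraph induced on \<open>S\<close> has an eigenvalue at least \<open>c\<close>.\<close>

definition subeigen :: "real \<Rightarrow> 'v set \<Rightarrow> ('v \<Rightarrow> real) \<Rightarrow> bool" where
  "subeigen c S y \<longleftrightarrow> S \<subseteq> V \<and> (\<forall>v. 0 \<le> y v) \<and> (\<forall>v. v \<notin> S \<longrightarrow> y v = 0) \<and> (\<exists>v\<in>S. 0 < y v) \<and>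
    (\<forall>v\<in>S. c * y v \<le> (\<Sum>w\<in>V. adj v w * y w))"

lemma quad_eq: "quad x = (\<Sum>v\<in>V. x v * (\<Sum>w\<in>V. adj v w * x w))"
  by (simp add: quad_def sum_distrib_left mult_ac)

lemma nsq_pos: "v \<in> V \<Longrightarrow> x v \<noteq> 0 \<Longrightarrow> 0 < nsq x"
  unfolding nsq_def using fin by (intro sum_pos2[of _ v]) auto

lemma subeigen_quad:
  assumes "subeigen c S y"
  shows "c * nsq y \<le> quad y"
proof -
  have "c * nsq y = (\<Sum>v\<in>V. y v * (c * y v))"
    by (simp add: nsq_def sum_distrib_left power2_eq_square mult_ac)
  also have "\<dots> \<le> quad y"
    unfolding quad_eq
  proof (rule sum_mono)
    fix v assume "v \<in> V"
    show "y v * (c * y v) \<le> y v * (\<Sum>w\<in>V. adj v w * y w)"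
      using assms by (cases "v \<in> S") (auto simp: subeigen_def intro!: mult_left_mono)
  qed
  finally show ?thesis .
qed

lemma subeigen_nsq_pos: "subeigen c S y \<Longrightarrow> 0 < nsq y"
  by (auto simp: subeigen_def intro: nsq_pos)

text \<open>Weights on indices are carried to the vertices by \<open>p\<close>. The sets
  \<open>nb i\<close> may omit neighbours, as further edges only raise a sum of nonnegative weights;
  hence the pattern may be a non-induced subgraph.\<close>

lemma subeigen_indexed:
  assumes inj: "inj_on p {..k::nat}" and pV: "\<And>i. i \<le> k \<Longrightarrow> p i \<in> V"
    and s: "\<And>i. i \<le> k \<Longrightarrow> 0 \<le> s i" "0 < s 0"
    and nb: "\<And>i. i \<le> k \<Longrightarrow> nb i \<subseteq> {..k}" "\<And>i j. i \<le> k \<Longrightarrow> j \<in> nb i \<Longrightarrow> (p i, p j) \<in> E"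
    and c: "\<And>i. i \<le> k \<Longrightarrow> c * s i \<le> (\<Sum>j\<in>nb i. s j)"
  obtains y where "subeigen c (p ` {..k}) y"
proof -
  define y where "y = (\<lambda>v. if v \<in> p ` {..k} then s (the_inv_into {..k} p v) else 0)"
  have yp: "y (p i) = s i" if "i \<le> k" for i
    using that by (simp add: y_def the_inv_into_f_f[OF inj])
  have y0: "0 \<le> y v" for v
  proof (cases "v \<in> p ` {..k}")
    case True
    then show ?thesis using yp s by auto
  qed (simp add: y_def)
  have "c * y (p i) \<le> (\<Sum>w\<in>V. adj (p i) w * y w)" if i: "i \<le> k" for i
  proof -
    have "(\<Sum>j\<in>nb i. s j) = (\<Sum>w\<in>p ` nb i. adj (p i) w * y w)"
      using nb[OF i] inj_on_subset[OF inj nb(1)[OF i]]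
      by (subst sum.reindex) (auto simp: adj_def yp subset_iff intro!: sum.cong)
    also have "\<dots> \<le> (\<Sum>w\<in>V. adj (p i) w * y w)"
      using fin y0 nb[OF i] pV by (intro sum_mono2) (auto simp: subset_iff)
    finally show ?thesis using c[OF i] yp[OF i] by simp
  qed
  moreover have "p 0 \<in> p ` {..k}" "0 < y (p 0)" using yp[of 0] s by auto
  ultimately have "subeigen c (p ` {..k}) y"
    unfolding subeigen_def using pV y0 by (auto simp: y_def intro!: bexI[of _ "p 0"])
  then show ?thesis by (rule that)
qed

text \<open>The weights \<open>sin (real (i + 1) * \<phi>)\<close> form the positive eigenvector of
  the path.\<close>

lemma subeigen_path:
  assumes inj: "inj_on p {..k::nat}" and E: "\<And>i. i < k \<Longrightarrow> (p i, p (Suc i)) \<in> E" and k: "k \<ge> 1"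
  obtains y where "subeigen (2 * cos (pi / real (k + 2))) (p ` {..k}) y"
proof -
  define \<phi> where "\<phi> = pi / real (k + 2)"
  define nb where "nb = (\<lambda>i. {j. j \<le> k \<and> (Suc j = i \<or> j = Suc i)})"
  \<comment> \<open>The weight of a fictitious vertex after the last one. With \<open>sin 0\<close>
    before the first, the recurrence is exact at both ends.\<close>
  have end0: "sin (real (k + 2) * \<phi>) = 0" by (simp add: \<phi>_def)
  have pV: "p i \<in> V" if "i \<le> k" for i
    using E[of i] E[of "i - 1"] that k edge_in by (cases "i < k") auto
  have s: "0 < sin (real (i + 1) * \<phi>)" if "i \<le> k" for i
  proof (rule sin_gt_zero)
    show "0 < real (i + 1) * \<phi>" by (simp add: \<phi>_def)
    have "real (i + 1) * pi < real (k + 2) * pi" using that by (intro mult_strict_right_mono) auto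
    then show "real (i + 1) * \<phi> < pi" by (simp add: \<phi>_def divide_less_eq mult_ac)
  qed
  have c: "2 * cos \<phi> * sin (real (i + 1) * \<phi>) \<le> (\<Sum>j\<in>nb i. sin (real (j + 1) * \<phi>))" if i: "i \<le> k" for i
  proof -
    have "nb i = (if i = 0 then {} else {i - 1}) \<union> (if i = k then {} else {Suc i})"
      using i by (auto simp: nb_def)
    then have "(\<Sum>j\<in>nb i. sin (real (j + 1) * \<phi>))
        = (if i = 0 then 0 else sin (real i * \<phi>)) + (if i = k then 0 else sin (real (i + 2) * \<phi>))"
      by (auto simp: of_nat_diff algebra_simps)
    also have "\<dots> = sin (real i * \<phi>) + sin (real (i + 2) * \<phi>)"
      using end0 by auto
    finally show ?thesis using sin_three_term[of i \<phi>] by simp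
  qed
  show ?thesis
  proof (rule subeigen_indexed[OF inj pV, of "\<lambda>i. sin (real (i + 1) * \<phi>)" nb "2 * cos \<phi>"])
    show "\<And>i j. i \<le> k \<Longrightarrow> j \<in> nb i \<Longrightarrow> (p i, p j) \<in> E"
      using E edge_sym by (auto simp: nb_def)
    show "\<And>i. i \<le> k \<Longrightarrow> 0 \<le> sin (real (i + 1) * \<phi>)" using s less_imp_le by blast
    show "0 < sin (real (0 + 1) * \<phi>)" using s by blast
    show "\<And>i. i \<le> k \<Longrightarrow> nb i \<subseteq> {..k}" by (auto simp: nb_def)
    show "\<And>i. i \<le> k \<Longrightarrow> 2 * cos \<phi> * sin (real (i + 1) * \<phi>) \<le> (\<Sum>j\<in>nb i. sin (real (j + 1) * \<phi>))"
      by (rule c)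
    show "\<And>y. subeigen (2 * cos \<phi>) (p ` {..k}) y \<Longrightarrow> thesis" using that by (simp add: \<phi>_def)
  qed
qed

text \<open>The arm \<open>p 0, \<dots>, p (k - 2)\<close> carries the weights of the path on \<open>k + 1\<close> vertices, and the weight of the
  leaves \<open>p (k - 1)\<close> and \<open>p k\<close> is chosen to give equality at the leaves. What remains is the
  inequality \<open>sin \<phi> \<le> sin (3 * \<phi>)\<close>, which is where \<open>k \<ge> 2\<close> enters.\<close>

lemma subeigen_fork:
  assumes inj: "inj_on p {..k::nat}" and k: "k \<ge> 2"
    and E: "\<And>i. i + 1 < k \<Longrightarrow> (p i, p (Suc i)) \<in> E" and E': "(p (k - 2), p k) \<in> E"
  obtains y where "subeigen (2 * cos (pi / real (k + 2))) (p ` {..k}) y"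
proof -
  define \<phi> where "\<phi> = pi / real (k + 2)"
  define c where "c = 2 * cos \<phi>"
  define s where "s = (\<lambda>i. if i + 1 < k then sin (real (i + 1) * \<phi>) else sin (real (k - 1) * \<phi>) / c)"
  define nb where "nb = (\<lambda>i. {j. j \<le> k \<and> (j + 1 < k \<and> Suc j = i \<or> j = Suc i \<and> i + 1 < k
      \<or> i = k \<and> j = k - 2 \<or> i = k - 2 \<and> j = k)})"
  have phi: "0 < \<phi>" "\<phi> \<le> pi / 4" using k frac_le[of pi pi 4 "real (k + 2)"] by (simp_all add: \<phi>_def)
  have cpos: "0 < c" using phi pi_gt_zero by (auto simp: c_def intro!: cos_gt_zero)
  have pV: "p i \<in> V" if i: "i \<le> k" for i
  proof -
    consider "i + 1 < k" | "i + 1 = k" | "i = k" using i by linarith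
    then show ?thesis
    proof cases
      case 2
      then have "Suc (k - 2) = i" "k - 2 + 1 < k" using k by auto
      then show ?thesis using E[of "k - 2"] edge_in by metis
    qed (use E[of i] E' edge_in in auto)
  qed
  have sp: "0 < sin (real i * \<phi>)" if "1 \<le> i" "i \<le> k + 1" for i
  proof (rule sin_gt_zero)
    show "0 < real i * \<phi>" using that phi by simp
    have "real i * pi < real (k + 2) * pi" using that by (intro mult_strict_right_mono) auto
    then show "real i * \<phi> < pi" by (simp add: \<phi>_def divide_less_eq mult_ac)
  qed
  have spos: "0 < s i" if "i \<le> k" for i
    using sp[of "i + 1"] sp[of "k - 1"] that k cpos by (auto simp: s_def)
  have last: "c * sin (real k * \<phi>) \<le> 2 * sin (real (k - 1) * \<phi>)"
  proof -
    have e1: "real (k - 1) * \<phi> = pi - 3 * \<phi>" and e2: "real (k + 1) * \<phi> = pi - \<phi>"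
      using k by (simp_all add: \<phi>_def of_nat_diff field_simps)
    have "c * sin (real k * \<phi>) = sin (real (k - 1) * \<phi>) + sin (real (k + 1) * \<phi>)"
      using sin_three_term[of "k - 1" \<phi>] k by (simp add: c_def)
    also have "sin (real (k + 1) * \<phi>) = sin \<phi>" unfolding e2 by simp
    also have "\<dots> \<le> sin (real (k - 1) * \<phi>)"
    proof -
      have "sin (3 * \<phi>) - sin \<phi> = 2 * sin \<phi> * cos (2 * \<phi>)"
        using sin_diff_sin[of "3 * \<phi>" \<phi>] by simp
      moreover have "0 \<le> sin \<phi>" using phi by (intro sin_ge_zero) auto
      moreover have "0 \<le> cos (2 * \<phi>)" using phi by (intro cos_ge_zero) auto
      ultimately have "0 \<le> sin (3 * \<phi>) - sin \<phi>" by (metis mult_nonneg_nonneg zero_le_numeral)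
      then show ?thesis unfolding e1 by simp
    qed
    finally show ?thesis by simp
  qed
  have k2: "k - 2 + 1 = k - 1" "k - 2 + 2 = k" using k by auto
  have sk: "s (k - 2) = sin (real (k - 1) * \<phi>)" using k unfolding s_def k2 by simp
  have cs: "c * s i \<le> (\<Sum>j\<in>nb i. s j)" if i: "i \<le> k" for i
  proof -
    consider (leaf) "k \<le> i + 1" | (stem) "i = k - 2" | (arm) "i + 2 < k" using k by linarith
    then show ?thesis
    proof cases
      case leaf
      then have "nb i = {k - 2}" using i k by (auto simp: nb_def)
      moreover have "s i = sin (real (k - 1) * \<phi>) / c" using leaf by (simp add: s_def)
      ultimately show ?thesis using cpos sk by simp
    next
      case stem
      define r where "r = sin (real (k - 1) * \<phi>) / c"
      \<comment> \<open>For \<open>k = 2\<close> the stem is \<open>p 0\<close>, which has no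
        predecessor; the value \<open>sin 0\<close> takes the place of the missing weight.\<close>
      have nb: "nb i = (if k = 2 then {} else {k - 3}) \<union> {k - 1, k}"
        using stem k by (auto simp: nb_def)
      have "(\<Sum>j\<in>nb i. s j) = (if k = 2 then 0 else s (k - 3)) + (s (k - 1) + s k)"
        unfolding nb using k by (subst sum.union_disjoint) auto
      also have "s (k - 1) + s k = r + r" using k by (auto simp: s_def r_def)
      also have "(if k = 2 then 0 else s (k - 3)) = sin (real (k - 2) * \<phi>)"
      proof (cases "k = 2")
        case False
        then have "k - 3 + 1 = k - 2" using k by simp
        then show ?thesis using False k by (simp add: s_def)
      qed simp
      finally have sum: "(\<Sum>j\<in>nb i. s j) = sin (real (k - 2) * \<phi>) + (r + r)" .
      have "c * s i = c * sin (real (k - 1) * \<phi>)"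
        by (simp add: stem sk)
      also have "\<dots> = sin (real (k - 2) * \<phi>) + sin (real k * \<phi>)"
        using sin_three_term[of "k - 2" \<phi>] unfolding k2 by (simp add: c_def)
      also have "sin (real k * \<phi>) \<le> r + r"
        using last cpos by (simp add: r_def field_simps)
      finally show ?thesis unfolding sum by simp
    next
      case arm
      have nb: "nb i = (if i = 0 then {} else {i - 1}) \<union> {Suc i}"
        using arm by (auto simp: nb_def)
      have "(\<Sum>j\<in>nb i. s j) = (if i = 0 then 0 else s (i - 1)) + s (Suc i)"
        unfolding nb by auto
      also have "\<dots> = sin (real i * \<phi>) + sin (real (i + 2) * \<phi>)"
        using arm by (auto simp: s_def algebra_simps of_nat_diff)
      finally show ?thesis using sin_three_term[of i \<phi>] arm by (simp add: s_def c_def)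
    qed
  qed
  have "(p i, p j) \<in> E" if "i \<le> k" "j \<in> nb i" for i j
    using that E[of i] E[of j] E' edge_sym by (auto simp: nb_def)
  from subeigen_indexed[OF inj pV less_imp_le[OF spos] spos _ this cs] show ?thesis
    using that by (auto simp: nb_def c_def \<phi>_def)
qed

end

section \<open>Traces, Rayleigh quotients and the two largest eigenvalues\<close>

locale spectral_edge_relation = edge_relation V E
  for V :: "'v set" and E :: "'v rel" +
  fixes m :: nat and u :: "nat \<Rightarrow> 'v \<Rightarrow> real" and \<nu> :: "nat \<Rightarrow> real"
  assumes on: "orthonormal_family V m u"
    and dec: "v \<in> V \<Longrightarrow> w \<in> V \<Longrightarrow> adj v w = (\<Sum>l<m. \<nu> l * u l v * u l w)"
begin

lemma adj_mult:
  assumes "v \<in> V"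
  shows "(\<Sum>w\<in>V. adj v w * x w) = (\<Sum>l<m. \<nu> l * u l v * (\<Sum>w\<in>V. u l w * x w))"
proof -
  have "(\<Sum>w\<in>V. adj v w * x w) = (\<Sum>w\<in>V. \<Sum>l<m. \<nu> l * u l v * u l w * x w)"
    using assms by (intro sum.cong refl) (simp add: dec sum_distrib_right)
  then show ?thesis by (subst (asm) sum.swap) (simp add: sum_distrib_left mult_ac)
qed

lemma eigen:
  assumes "l < m" "v \<in> V"
  shows "(\<Sum>w\<in>V. adj v w * u l w) = \<nu> l * u l v"
proof -
  have "(\<Sum>w\<in>V. adj v w * u l w) = (\<Sum>l'<m. if l' = l then \<nu> l' * u l' v else 0)"
    unfolding adj_mult[OF assms(2)]
    by (intro sum.cong refl) (simp add: orthonormal_familyD[OF on] assms)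
  then show ?thesis using assms by simp
qed

lemma nsq_unit: "l < m \<Longrightarrow> nsq (u l) = 1"
  using orthonormal_familyD[OF on, of l l] by (simp add: nsq_def power2_eq_square)

text \<open>The family may fail to span, but directions orthogonal to it are annihilated by the
  adjacency form. They are invisible for \<open>n \<ge> 1\<close>, whereas \<open>n = 0\<close>
  would require completeness.\<close>

lemma walks_spectral:
  assumes "n \<ge> 1" "v \<in> V" "w \<in> V"
  shows "walks n v w = (\<Sum>l<m. \<nu> l ^ n * u l v * u l w)"
  using assms(1,3)
proof (induction n arbitrary: w rule: nat_induct_at_least)
  case base
  have "walks (Suc 0) v w = (\<Sum>z\<in>V. if z = v then adj z w else 0)"
    by (simp add: of_bool_def if_distrib[of "\<lambda>r. r * _"] eq_commute[of v] cong: if_cong)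
  then show ?case using fin assms(2) dec[of v w] base by simp
next
  case (Suc n)
  have "walks (Suc n) v w = (\<Sum>z\<in>V. (\<Sum>l<m. \<nu> l ^ n * u l v * u l z) * adj z w)"
    using Suc by simp
  also have "\<dots> = (\<Sum>l<m. \<nu> l ^ n * u l v * (\<Sum>z\<in>V. adj w z * u l z))"
    unfolding sum_distrib_right
    by (subst sum.swap) (simp add: sum_distrib_left mult_ac adj_sym[of _ w])
  also have "\<dots> = (\<Sum>l<m. \<nu> l ^ Suc n * u l v * u l w)"
    by (intro sum.cong refl) (simp add: eigen Suc.prems)
  finally show ?case .
qed

lemma trace_walks:
  assumes "n \<ge> 1"
  shows "(\<Sum>v\<in>V. walks n v v) = (\<Sum>l<m. \<nu> l ^ n)"
proof -
  have "(\<Sum>v\<in>V. walks n v v) = (\<Sum>v\<in>V. \<Sum>l<m. \<nu> l ^ n * (u l v * u l v))"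
    using assms by (simp add: walks_spectral mult.assoc)
  also have "\<dots> = (\<Sum>l<m. \<nu> l ^ n * (\<Sum>v\<in>V. u l v * u l v))"
    by (subst sum.swap) (simp add: sum_distrib_left)
  finally show ?thesis using orthonormal_familyD[OF on] by simp
qed

lemma quad_spectral: "quad x = (\<Sum>l<m. \<nu> l * (\<Sum>v\<in>V. u l v * x v)\<^sup>2)"
proof -
  have "quad x = (\<Sum>v\<in>V. \<Sum>l<m. x v * (\<nu> l * u l v * (\<Sum>w\<in>V. u l w * x w)))"
    unfolding quad_eq by (intro sum.cong refl) (simp add: adj_mult sum_distrib_left)
  also have "\<dots> = (\<Sum>l<m. \<Sum>v\<in>V. x v * (\<nu> l * u l v * (\<Sum>w\<in>V. u l w * x w)))"
    by (rule sum.swap)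
  also have "\<dots> = (\<Sum>l<m. \<nu> l * (\<Sum>v\<in>V. u l v * x v)\<^sup>2)"
    by (intro sum.cong refl)
      (simp add: power2_eq_square sum_distrib_left sum_distrib_right mult_ac)
  finally show ?thesis .
qed

text \<open>If all eigenvalues met by \<open>x\<close> were below \<open>c\<close>, Bessel would
  push its Rayleigh quotient below \<open>c\<close>; positivity of \<open>c\<close> covers
  directions outside the family. \<open>J = UNIV\<close> serves the largest eigenvalue,
  \<open>J = - {i}\<close> the next one.\<close>

lemma eigenvalue_ge_of_quad:
  assumes c: "0 < c" and x: "0 < nsq x" and q: "c * nsq x \<le> quad x"
    and J: "\<And>l. l < m \<Longrightarrow> l \<notin> J \<Longrightarrow> (\<Sum>v\<in>V. u l v * x v) = 0"
  obtains j where "j < m" "j \<in> J" "c \<le> \<nu> j"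
proof (rule ccontr)
  assume "\<not> thesis"
  then have lt: "\<nu> j < c" if "j < m" "j \<in> J" for j
    using that \<open>\<And>j. j < m \<Longrightarrow> j \<in> J \<Longrightarrow> c \<le> \<nu> j \<Longrightarrow> thesis\<close> not_le by blast
  define p where "p = (\<lambda>l. \<Sum>v\<in>V. u l v * x v)"
  have qs: "quad x = (\<Sum>l<m. \<nu> l * (p l)\<^sup>2)" by (simp add: quad_spectral p_def)
  have le: "\<nu> l * (p l)\<^sup>2 \<le> c * (p l)\<^sup>2" if "l < m" for l
    using lt[of l] J[of l] that by (cases "l \<in> J") (auto intro!: mult_right_mono simp: p_def)
  have "0 < c * nsq x" using c x by simp
  then have "quad x \<noteq> 0" using q by linarith
  moreover have "quad x = 0" if "\<forall>l<m. p l = 0" using that by (simp add: qs)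
  ultimately have "\<not> (\<forall>l<m. p l = 0)" by blast
  then obtain l where l: "l < m" "p l \<noteq> 0" by blast
  then have "\<nu> l * (p l)\<^sup>2 < c * (p l)\<^sup>2"
    using lt[of l] J[of l] by (cases "l \<in> J") (auto simp: p_def)
  then have "quad x < (\<Sum>l<m. c * (p l)\<^sup>2)"
    unfolding qs using le l by (intro sum_strict_mono_ex1) (auto intro!: bexI[of _ l])
  also have "\<dots> \<le> c * nsq x"
    using bessel[OF on, of x] c by (simp add: p_def nsq_def flip: sum_distrib_left)
  finally show False using q by simp
qed

text \<open>Perron-Frobenius in variational form: replacing an eigenvector by its absolute values
  keeps the norm and cannot lower the modulus of the form.\<close>

lemma abs_eigenvalue_le:
  assumes "l < m"
  obtains j where "j < m" "\<bar>\<nu> l\<bar> \<le> \<nu> j"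
proof (cases "\<nu> l = 0")
  case True
  then show ?thesis using that assms by auto
next
  case False
  define x where "x = (\<lambda>v. \<bar>u l v\<bar>)"
  have n: "nsq x = 1" using nsq_unit[OF assms] by (simp add: nsq_def x_def)
  have "quad (u l) = \<nu> l * nsq (u l)"
  proof -
    have "quad (u l) = (\<Sum>v\<in>V. u l v * (\<nu> l * u l v))"
      unfolding quad_eq by (intro sum.cong refl) (simp add: eigen assms)
    then show ?thesis by (simp add: nsq_def power2_eq_square sum_distrib_left mult_ac)
  qed
  then have "\<bar>\<nu> l\<bar> = \<bar>quad (u l)\<bar>" using nsq_unit[OF assms] by simp
  also have "\<dots> \<le> (\<Sum>v\<in>V. \<Sum>w\<in>V. \<bar>adj v w * u l v * u l w\<bar>)"
    unfolding quad_def by (intro order.trans[OF sum_abs] sum_mono sum_abs)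
  also have "\<dots> = quad x" by (simp add: quad_def x_def abs_mult)
  finally have "\<bar>\<nu> l\<bar> * nsq x \<le> quad x" using n by simp
  from eigenvalue_ge_of_quad[OF _ _ this, of UNIV] show ?thesis
    using False n that by auto
qed

lemma top_eigenvalue:
  assumes "0 < m"
  obtains i where "i < m" "\<And>l. l < m \<Longrightarrow> \<bar>\<nu> l\<bar> \<le> \<nu> i"
proof -
  have "Max (\<nu> ` {..<m}) \<in> \<nu> ` {..<m}" using assms by (intro Max_in) auto
  then obtain i where i: "i < m" "\<nu> i = Max (\<nu> ` {..<m})" by force
  have "\<bar>\<nu> l\<bar> \<le> \<nu> i" if l: "l < m" for l
  proof -
    obtain j where "j < m" "\<bar>\<nu> l\<bar> \<le> \<nu> j" using abs_eigenvalue_le[OF l] by blast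
    moreover have "\<nu> j \<le> \<nu> i" unfolding i(2) using \<open>j < m\<close> by (intro Max_ge) auto
    ultimately show ?thesis by linarith
  qed
  then show ?thesis using that i by blast
qed

text \<open>Separated supports remove all mixed terms, so every nonzero vector in the plane spanned
  by \<open>y\<close> and \<open>z\<close> has Rayleigh quotient at least \<open>c\<close>, and the
  plane contains one orthogonal to \<open>u i\<close>.\<close>

lemma second_eigenvalue_ge:
  assumes y: "subeigen c S y" and z: "subeigen c T z" and disj: "S \<inter> T = {}"
    and sep: "\<And>v w. v \<in> S \<Longrightarrow> w \<in> T \<Longrightarrow> (v, w) \<notin> E" and c: "0 < c"
  obtains j where "j < m" "j \<noteq> i" "c \<le> \<nu> j"
proof -
  define p r where "p = (\<Sum>v\<in>V. u i v * y v)" and "r = (\<Sum>v\<in>V. u i v * z v)"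
  \<comment> \<open>a combination of the two test vectors orthogonal to the excluded eigenvector\<close>
  obtain \<alpha> \<beta> where ab: "\<alpha> * p + \<beta> * r = 0" "\<alpha> \<noteq> 0 \<or> \<beta> \<noteq> 0"
  proof (cases "p = 0 \<and> r = 0")
    case True
    then show ?thesis using that[of 1 0] by simp
  next
    case False
    then show ?thesis using that[of r "- p"] by (auto simp: mult.commute)
  qed
  define x where "x = (\<lambda>v. \<alpha> * y v + \<beta> * z v)"
  have yS: "y v \<noteq> 0 \<Longrightarrow> v \<in> S" and zT: "z v \<noteq> 0 \<Longrightarrow> v \<in> T" for v
    using y z by (auto simp: subeigen_def)
  have yz: "y v * z v = 0" for v using yS[of v] zT[of v] disj by auto
  have cross: "adj v w * y v * z w = 0" "adj v w * z v * y w = 0" for v w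
    using yS[of v] zT[of w] yS[of w] zT[of v] sep[of v w] sep[of w v] edge_sym[of v w]
    by (auto simp: adj_def)
  have "(\<Sum>v\<in>V. u i v * x v) = \<alpha> * p + \<beta> * r"
    by (simp add: x_def p_def r_def distrib_left sum.distrib sum_distrib_left mult_ac)
  then have orth: "(\<Sum>v\<in>V. u i v * x v) = 0" using ab by simp
  have n: "nsq x = \<alpha>\<^sup>2 * nsq y + \<beta>\<^sup>2 * nsq z"
  proof -
    have "(x v)\<^sup>2 = \<alpha>\<^sup>2 * (y v)\<^sup>2 + \<beta>\<^sup>2 * (z v)\<^sup>2" for v
    proof -
      have "(x v)\<^sup>2 = \<alpha>\<^sup>2 * (y v)\<^sup>2 + \<beta>\<^sup>2 * (z v)\<^sup>2 + 2 * \<alpha> * \<beta> * (y v * z v)"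
        by (simp add: x_def power2_eq_square algebra_simps)
      then show ?thesis by (simp add: yz)
    qed
    then show ?thesis by (simp add: nsq_def sum.distrib sum_distrib_left)
  qed
  have "quad x = \<alpha>\<^sup>2 * quad y + \<beta>\<^sup>2 * quad z"
  proof -
    have "adj v w * x v * x w = \<alpha>\<^sup>2 * (adj v w * y v * y w) + \<beta>\<^sup>2 * (adj v w * z v * z w)" for v w
    proof -
      have "adj v w * x v * x w = \<alpha>\<^sup>2 * (adj v w * y v * y w) + \<beta>\<^sup>2 * (adj v w * z v * z w)
          + \<alpha> * \<beta> * (adj v w * y v * z w) + \<alpha> * \<beta> * (adj v w * z v * y w)"
        by (simp add: x_def power2_eq_square algebra_simps)
      then show ?thesis by (simp add: cross)
    qed
    then show ?thesis by (simp add: quad_def sum.distrib sum_distrib_left)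
  qed
  moreover have "\<alpha>\<^sup>2 * (c * nsq y) + \<beta>\<^sup>2 * (c * nsq z) \<le> \<alpha>\<^sup>2 * quad y + \<beta>\<^sup>2 * quad z"
    by (intro add_mono mult_left_mono subeigen_quad[OF y] subeigen_quad[OF z]) auto
  ultimately have q: "c * nsq x \<le> quad x" by (simp add: n algebra_simps)
  have "0 < nsq x"
    unfolding n using ab(2) subeigen_nsq_pos[OF y] subeigen_nsq_pos[OF z]
    by (auto intro: add_pos_nonneg add_nonneg_pos simp: less_imp_le)
  from eigenvalue_ge_of_quad[OF c this q, of "- {i}"] orth show ?thesis using that by auto
qed

end

section \<open>Shortest odd cycles\<close>

text \<open>Integer indices with period \<open>g\<close> allow offsets in both directions.
  Minimality speaks of closed walks; distinctness of the \<open>g\<close> vertices and the absence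
  of chords follow from it.\<close>

locale shortest_odd_cycle = edge_relation V E
  for V :: "'v set" and E :: "'v rel" +
  fixes g :: nat and C :: "int \<Rightarrow> 'v"
  assumes odd_g: "odd g"
    and period: "C (i + int g) = C i"
    and step: "(C i, C (i + 1)) \<in> E"
    and shortest: "odd n \<Longrightarrow> (v, v) \<in> E ^^ n \<Longrightarrow> g \<le> n"
begin

lemma C_in: "C i \<in> V"
  using step edge_in by blast

lemma step_back: "(C i, C (i - 1)) \<in> E"
  using step[of "i - 1"] edge_sym by simp

lemma C_walk: "(C i, C (i + int n)) \<in> E ^^ n"
proof (induction n)
  case (Suc n)
  then show ?case using step[of "i + int n"] by (auto simp: algebra_simps)
qed simp

lemma C_closed: "(C i, C i) \<in> E ^^ g"
  using C_walk[of i g] by (simp add: period)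

text \<open>A walk between two vertices of \<open>C\<close> cannot be shorter than the arc of \<open>C\<close> of the same parity,
  for closing it up along the other arc gives an odd closed walk.\<close>

lemma walk_length_ge:
  assumes w: "(C i, C (i + int d)) \<in> E ^^ r" and d: "d \<le> g"
  shows "odd (r + d) \<Longrightarrow> g \<le> r + d" and "even (r + d) \<Longrightarrow> d \<le> r"
proof -
  show "g \<le> r + d" if "odd (r + d)"
    using shortest[OF that] relpow_trans[OF w relpow_sym[OF C_walk]] by blast
  show "d \<le> r" if "even (r + d)"
  proof -
    have "(C (i + int d), C i) \<in> E ^^ (g - d)"
      using C_walk[of "i + int d" "g - d"] d period[of i] by simp
    from relpow_trans[OF w this] have "(C i, C i) \<in> E ^^ (r + (g - d))" .
    moreover have "odd (r + (g - d))" using that odd_g d by auto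
    ultimately have "g \<le> r + (g - d)" using shortest by blast
    then show ?thesis using d by simp
  qed
qed

lemma C_neq: "0 < d \<Longrightarrow> d < g \<Longrightarrow> C i \<noteq> C (i + int d)"
  using walk_length_ge[of i d 0] by fastforce

lemma C_adjacent: "d < g \<Longrightarrow> (C i, C (i + int d)) \<in> E \<Longrightarrow> d = 1 \<or> d = g - 1"
proof -
  assume d: "d < g" and e: "(C i, C (i + int d)) \<in> E"
  then have "(C i, C (i + int d)) \<in> E ^^ 1" by simp
  from walk_length_ge[OF this] d odd_g have "odd d \<Longrightarrow> d \<le> 1" "even d \<Longrightarrow> g \<le> 1 + d" by auto
  then show ?thesis using d by (cases "even d") (auto dest: odd_pos)
qed

text \<open>The two-step walk through \<open>u\<close> is at least as long as the arc of its parity: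
  an even \<open>d\<close> is at most 2, and an odd \<open>d\<close> is at least
  \<open>g - 2\<close>, hence equal to it since \<open>g - 1\<close> is even.\<close>

lemma C_common_neighbour:
  assumes "d < g" "(u, C i) \<in> E" "(u, C (i + int d)) \<in> E"
  shows "d = 0 \<or> d = 2 \<or> d = g - 2"
proof -
  have "(C i, C (i + int d)) \<in> E ^^ 2"
    using assms edge_sym by (auto simp: numeral_2_eq_2)
  from walk_length_ge[OF this] assms(1) have "odd d \<Longrightarrow> g \<le> 2 + d" "even d \<Longrightarrow> d \<le> 2" by auto
  then show ?thesis using assms(1) odd_g by (cases "even d") (auto elim!: evenE oddE)
qed

lemma inj_C: "inj_on (\<lambda>j. C (i + int j)) {..<g}"
proof (rule linorder_inj_onI)
  fix a b assume "a < b" "a \<in> {..<g}" "b \<in> {..<g}"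
  then show "C (i + int a) \<noteq> C (i + int b)"
    using C_neq[of "b - a" "i + int a"] by (simp add: of_nat_diff)
qed auto

lemma C_mod: "C (i + int g * z) = C i"
proof (induction z rule: int_induct[where k = 0])
  case (step1 z)
  then show ?case using period[of "i + int g * z"] by (simp add: algebra_simps)
next
  case (step2 z)
  then show ?case using period[of "i + int g * (z - 1)"] by (simp add: algebra_simps)
qed simp

lemma g_pos: "0 < g"
  using odd_g odd_pos by blast

lemma C_offset:
  obtains d where "d < g" "C j = C (i + int d)"
proof -
  define d where "d = nat ((j - i) mod int g)"
  have d: "int d = (j - i) mod int g" using g_pos by (simp add: d_def)
  have "d < g" using g_pos by (simp add: d_def nat_less_iff)
  moreover have "j = i + int d + int g * ((j - i) div int g)"
    unfolding d by (simp add: algebra_simps)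
  then have "C j = C (i + int d)" using C_mod by metis
  ultimately show ?thesis by (rule that)
qed

lemma range_C: "range C = (\<lambda>j. C (i + int j)) ` {..<g}"
proof -
  have "C j \<in> (\<lambda>j. C (i + int j)) ` {..<g}" for j
    using C_offset[of j i] by (metis imageI lessThan_iff)
  then show ?thesis by auto
qed

lemma g_ge3: "3 \<le> g"
proof -
  have "g \<noteq> 1" using step[of 0] period[of 0] by auto
  then show ?thesis using odd_g g_pos by (cases "g = 2") auto
qed

lemma C_pred_succ: "C (i - 1) \<noteq> C (i + 1)"
  using C_neq[of 2 "i - 1"] g_ge3 by (simp add: add.commute)

text \<open>Walks on \<open>C\<close> with \<open>r\<close> forward and \<open>n - r\<close>
  backward steps, counted by Pascal's rule. Other walks may share the endpoints, so this is a lower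
  bound.\<close>

lemma walks_binomial: "real (n choose r) \<le> walks n (C i) (C (i + 2 * int r - int n))"
proof (induction n arbitrary: r)
  case 0
  then show ?case by (cases r) auto
next
  case (Suc n)
  define j where "j = i + 2 * int r - int (Suc n)"
  have "walks n (C i) (C (j - 1)) + walks n (C i) (C (j + 1))
      = (\<Sum>w\<in>{C (j - 1), C (j + 1)}. walks n (C i) w * adj w (C j))"
    using step[of "j - 1"] step_back[of "j + 1"] C_pred_succ[of j] by (simp add: adj_def)
  also have "\<dots> \<le> walks (Suc n) (C i) (C j)"
    unfolding walks.simps using fin C_in by (intro sum_mono2) auto
  finally have le: "walks n (C i) (C (j - 1)) + walks n (C i) (C (j + 1)) \<le> walks (Suc n) (C i) (C j)" .
  have "real (Suc n choose r) \<le> walks n (C i) (C (j - 1)) + walks n (C i) (C (j + 1))"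
  proof (cases r)
    case 0
    then have "j + 1 = i + 2 * int 0 - int n" by (simp add: j_def)
    then have "1 \<le> walks n (C i) (C (j + 1))" using Suc.IH[of 0] by simp
    moreover have "real (Suc n choose r) = 1" by (simp add: 0)
    ultimately show ?thesis using walks_nonneg[of n "C i" "C (j - 1)"] by linarith
  next
    case (Suc r')
    have j: "j - 1 = i + 2 * int r' - int n" "j + 1 = i + 2 * int r - int n"
      by (auto simp: j_def Suc)
    have "real (Suc n choose r) = real (n choose r') + real (n choose r)" by (simp add: Suc)
    then show ?thesis using Suc.IH[of r'] Suc.IH[of r] unfolding j by linarith
  qed
  with le show ?case by (simp add: j_def)
qed

lemma trace_ge_binomial: "real g * real (2 * n choose n) \<le> (\<Sum>v\<in>V. walks (2 * n) v v)"
proof -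
  have "real g * real (2 * n choose n) = (\<Sum>j<g. real (2 * n choose n))" by simp
  also have "\<dots> \<le> (\<Sum>j<g. walks (2 * n) (C (int j)) (C (int j)))"
    by (intro sum_mono) (use walks_binomial[of "2 * n" n] in auto)
  also have "\<dots> = (\<Sum>v\<in>(\<lambda>j. C (int j)) ` {..<g}. walks (2 * n) v v)"
    using inj_C[of 0] by (simp add: sum.reindex)
  also have "\<dots> \<le> (\<Sum>v\<in>V. walks (2 * n) v v)"
    using fin C_in by (intro sum_mono2) auto
  finally show ?thesis .
qed

lemma subeigen_C: "subeigen 2 (range C) (\<lambda>v. of_bool (v \<in> range C))"
proof -
  have "2 \<le> (\<Sum>w\<in>V. adj (C i) w * of_bool (w \<in> range C))" for i
  proof -
    have "2 = (\<Sum>w\<in>{C (i - 1), C (i + 1)}. adj (C i) w * of_bool (w \<in> range C))"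
      using step[of i] step_back[of i] C_pred_succ[of i] by (simp add: adj_def)
    also have "\<dots> \<le> (\<Sum>w\<in>V. adj (C i) w * of_bool (w \<in> range C))"
      using fin C_in by (intro sum_mono2) auto
    finally show ?thesis .
  qed
  then show ?thesis using C_in unfolding subeigen_def by auto
qed

lemma neighbours_in_C:
  assumes "(C i, C j) \<in> E"
  shows "C j = C (i - 1) \<or> C j = C (i + 1)"
proof -
  obtain d where d: "d < g" "C j = C (i + int d)" by (rule C_offset)
  with C_adjacent[of d i] assms have "d = 1 \<or> d = g - 1" by simp
  moreover have "C (i + int (g - 1)) = C (i - 1)"
    using period[of "i - 1"] g_pos by (simp add: of_nat_diff algebra_simps)
  ultimately show ?thesis using d by auto
qed

lemma isolated_C_eigen:
  assumes iso: "\<And>u i. (u, C i) \<in> E \<Longrightarrow> u \<in> range C" and v: "v \<in> V"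
  shows "(\<Sum>w\<in>V. adj v w * of_bool (w \<in> range C)) = 2 * of_bool (v \<in> range C)"
proof (cases "v \<in> range C")
  case False
  then have "adj v w * of_bool (w \<in> range C) = 0" for w
    using iso[of v] by (auto simp: adj_def)
  then show ?thesis using False by (auto intro: sum.neutral)
next
  case True
  then obtain i where i: "v = C i" by auto
  have "2 = (\<Sum>w\<in>{C (i - 1), C (i + 1)}. adj v w * of_bool (w \<in> range C))"
    using step[of i] step_back[of i] C_pred_succ[of i] by (simp add: adj_def i)
  also have "\<dots> = (\<Sum>w\<in>V. adj v w * of_bool (w \<in> range C))"
    using fin C_in neighbours_in_C[of i] by (intro sum.mono_neutral_left) (auto simp: adj_def i)
  finally show ?thesis using True by simp
qed

lemma C_separated:
  assumes "2 \<le> d" "d + 2 \<le> g"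
  shows "C i \<noteq> C (i + int d)" "(C i, C (i + int d)) \<notin> E"
  using C_neq[of d i] C_adjacent[of d i] assms by auto

end

section \<open>Large odd girth\<close>

text \<open>On \<open>{0..pi / 4}\<close> the sine is concave and lies above its chord, here at the
  fraction \<open>4 / (k + 2)\<close>. The resulting rational bound is sharp at
  \<open>k = 2\<close>.\<close>

lemma sin_squared_ge:
  assumes "k \<ge> 2"
  shows "8 / (real (k + 2))\<^sup>2 \<le> (sin (pi / real (k + 2)))\<^sup>2"
proof -
  have conc: "concave_on {0..pi / 4} sin"
  proof (rule f''_le0_imp_concave)
    show "\<And>x::real. x \<in> {0..pi / 4} \<Longrightarrow> - sin x \<le> 0" by (auto intro!: sin_ge_zero)
  qed (auto intro!: derivative_eq_intros)
  define t where "t = 4 / real (k + 2)"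
  have t: "0 \<le> t" "t \<le> 1" using assms by (auto simp: t_def)
  have "t * sin (pi / 4) \<le> sin (t * (pi / 4))" 
    using concave_onD[OF conc t, of 0 "pi / 4"] pi_gt_zero by simp
  also have "t * (pi / 4) = pi / real (k + 2)" by (simp add: t_def field_simps)
  finally have "t * (sqrt 2 / 2) \<le> sin (pi / real (k + 2))" unfolding sin_45 .
  then have "(t * (sqrt 2 / 2))\<^sup>2 \<le> (sin (pi / real (k + 2)))\<^sup>2"
    using t by (intro power_mono) auto
  moreover have "t\<^sup>2 = 16 / (real (k + 2))\<^sup>2" by (simp add: t_def power_divide)
  moreover have "(sqrt 2 / 2)\<^sup>2 = (1 / 2 :: real)" by (simp add: power_divide)
  ultimately show ?thesis unfolding power_mult_distrib by simp
qed

lemma two_cos_power_le: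
  assumes "k \<ge> 2"
  shows "(2 * cos (pi / real (k + 2))) ^ (2 * k) \<le> (4 - 32 / (real (k + 2))\<^sup>2) ^ k"
proof -
  have "(2 * cos (pi / real (k + 2)))\<^sup>2 \<le> 4 - 32 / (real (k + 2))\<^sup>2"
    using sin_squared_ge[OF assms] by (simp add: power_mult_distrib cos_squared_eq)
  then show ?thesis unfolding power_mult by (intro power_mono) auto
qed

lemma central_binomial_Suc: "Suc k * (2 * Suc k choose Suc k) = 2 * (2 * k + 1) * (2 * k choose k)"
proof -
  have "Suc k * (2 * Suc k choose Suc k) = (2 * k + 2) * (2 * k + 1 choose k)"
    using Suc_times_binomial[of k "2 * k + 1"] by simp
  also have "(2 * k + 1 choose k) = (2 * k + 1 choose Suc k)"
    using binomial_symmetric[of k "2 * k + 1"] by simp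
  also have "(2 * k + 2) * \<dots> = 2 * (Suc k * (2 * k + 1 choose Suc k))" by simp
  also have "\<dots> = 2 * ((2 * k + 1) * (2 * k choose k))"
    using Suc_times_binomial[of k "2 * k"] by simp
  finally show ?thesis by simp
qed

text \<open>Raising \<open>k\<close> by one multiplies the right side by at least 4. The inequality
  still fails at 9, so the induction starts at 10.\<close>

lemma central_binomial_ge:
  assumes "k \<ge> 10"
  shows "4 * 4 ^ k \<le> (2 * k + 3) * (2 * k choose k)"
  using assms
proof (induction k rule: nat_induct_at_least)
  case base
  have "(20 choose 10 :: nat) = 184756" by (simp add: binomial_fact' fact_numeral)
  then show ?case by simp
next
  case (Suc k)
  have "Suc k * (4 * 4 ^ Suc k) = 4 * Suc k * (4 * 4 ^ k)" by (simp add: algebra_simps)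
  also have "\<dots> \<le> 4 * Suc k * ((2 * k + 3) * (2 * k choose k))"
    using Suc by (intro mult_left_mono) auto
  also have "\<dots> = (2 * ((2 * k + 2) * (2 * k + 3))) * (2 * k choose k)"
    by (simp add: algebra_simps)
  also have "\<dots> \<le> (2 * ((2 * k + 1) * (2 * k + 5))) * (2 * k choose k)"
    using Suc.hyps by (intro mult_right_mono) (auto simp: algebra_simps)
  also have "\<dots> = (2 * k + 5) * (Suc k * (2 * Suc k choose Suc k))"
    unfolding central_binomial_Suc by (simp add: algebra_simps)
  also have "\<dots> = Suc k * ((2 * Suc k + 3) * (2 * Suc k choose Suc k))"
    by (simp add: algebra_simps)
  finally show ?case by (simp only: mult_le_cancel1)
qed

lemma two_cos_bounds:
  assumes "k \<ge> 1"
  shows "0 < 2 * cos (pi / real (k + 2))" "2 * cos (pi / real (k + 2)) < 2"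
proof -
  have "pi / real (k + 2) < pi / 2" using assms by (intro divide_strict_left_mono) auto
  then show "0 < 2 * cos (pi / real (k + 2))" using cos_gt_zero by simp
  have "cos (pi / real (k + 2)) < cos 0"
  proof (rule cos_monotone_0_pi)
    show "pi / real (k + 2) \<le> pi" by (simp add: divide_le_eq)
  qed auto
  then show "2 * cos (pi / real (k + 2)) < 2" by simp
qed

text \<open>For the case that \<open>C\<close> is a component and 2 is the largest eigenvalue: the
  right side counts closed walks inside a cycle of length \<open>2 * k + 3\<close>. From 10 on, the
  cosine is bounded by 1; below, a rational bound leaves eight numerical checks.\<close>

lemma central_binomial_gap:
  assumes "k \<ge> 2"
  shows "2 * (2 ^ (2 * k) + (2 * cos (pi / real (k + 2))) ^ (2 * k))
    < real (2 * k + 3) * real (2 * k choose k)"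
proof (cases "k \<ge> 10")
  case True
  have gen: "Q < P \<Longrightarrow> P = F \<Longrightarrow> 2 * (P + Q) < 4 * F" for P Q F :: real by simp
  have "(2 * cos (pi / real (k + 2))) ^ (2 * k) < 2 ^ (2 * k)"
    using two_cos_bounds[of k] assms by (intro power_strict_mono) auto
  moreover have "(2 :: real) ^ (2 * k) = 4 ^ k" by (simp add: power_mult)
  ultimately have "2 * (2 ^ (2 * k) + (2 * cos (pi / real (k + 2))) ^ (2 * k)) < 4 * 4 ^ k"
    by (rule gen)
  also have "4 * 4 ^ k \<le> real (2 * k + 3) * real (2 * k choose k)"
    using of_nat_mono[OF central_binomial_ge[OF True], where 'a = real]
    by (simp only: of_nat_mult of_nat_power of_nat_numeral)
  finally show ?thesis .
next
  case False
  with assms have "k \<in> {2, 3, 4, 5, 6, 7, 8, 9}" by auto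
  then have "2 * (2 ^ (2 * k) + (4 - 32 / (real (k + 2))\<^sup>2) ^ k)
      < real (2 * k + 3) * real (2 * k choose k)"
    by (auto simp: binomial_fact' fact_numeral power_divide)
  moreover have gen: "Q \<le> R \<Longrightarrow> 2 * (P + R) < B \<Longrightarrow> 2 * (P + Q) < B" for P Q R B :: real by simp
  ultimately show ?thesis using two_cos_power_le[OF assms] by blast
qed

section \<open>Two separated subgraphs on and around the shortest odd cycle\<close>

locale spectral_odd_cycle =
  spectral_edge_relation V E m u \<nu> + shortest_odd_cycle V E g C
  for V :: "'v set" and E m u \<nu> g C
begin

lemma two_le_top:
  assumes i: "i < m" "\<And>l. l < m \<Longrightarrow> \<bar>\<nu> l\<bar> \<le> \<nu> i"
  shows "2 \<le> \<nu> i"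
proof -
  obtain j where "j < m" "2 \<le> \<nu> j"
    using eigenvalue_ge_of_quad[OF _ subeigen_nsq_pos[OF subeigen_C] subeigen_quad[OF subeigen_C], of UNIV]
    by auto
  then show ?thesis using i(2)[of j] by simp
qed

text \<open>The paths occupy the positions 0 to \<open>k\<close> and \<open>k + 2\<close> to
  \<open>2 * k + 2\<close>. One vertex separates them on one side and at least two on the
  other.\<close>

lemma second_eigenvalue_long_cycle:
  assumes k: "k \<ge> 1" and g: "2 * k + 5 \<le> g"
  obtains j where "j < m" "j \<noteq> i" "2 * cos (pi / real (k + 2)) \<le> \<nu> j"
proof -
  define p q where "p = (\<lambda>i. C (int i))" and "q = (\<lambda>i. C (int (k + 2) + int i))"
  have sub: "{..k} \<subseteq> {..<g}" using g by auto
  have "inj_on p {..k}" "inj_on q {..k}"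
    using inj_on_subset[OF inj_C[of 0] sub] inj_on_subset[OF inj_C[of "int (k + 2)"] sub]
    by (auto simp: p_def q_def)
  moreover have "(p i, p (Suc i)) \<in> E" "(q i, q (Suc i)) \<in> E" for i
    using step[of "int i"] step[of "int (k + 2) + int i"] by (auto simp: p_def q_def add_ac)
  ultimately obtain y z where "subeigen (2 * cos (pi / real (k + 2))) (p ` {..k}) y"
    "subeigen (2 * cos (pi / real (k + 2))) (q ` {..k}) z"
    using subeigen_path k by metis
  moreover have sep: "p a \<noteq> q b \<and> (p a, q b) \<notin> E" if "a \<le> k" "b \<le> k" for a b
  proof -
    have d: "2 \<le> k + 2 + b - a" "k + 2 + b - a + 2 \<le> g" using that g by auto
    have eq: "int a + int (k + 2 + b - a) = int (k + 2) + int b"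
      using that by (simp add: of_nat_diff)
    show ?thesis
      using C_separated[OF d, of "int a"] unfolding eq by (simp add: p_def q_def)
  qed
  ultimately show ?thesis
    using second_eigenvalue_ge[of _ "p ` {..k}" y "q ` {..k}" z i] two_cos_bounds[OF k] that by blast
qed

text \<open>One path starts at \<open>w\<close> and runs backwards from \<open>C s\<close>, the
  other covers the offsets 2 to \<open>k + 2\<close> from \<open>s\<close>. The vertices at offsets
  1 and \<open>- k\<close> separate them, and \<open>only\<close> keeps \<open>w\<close> away from
  the second path.\<close>

lemma second_eigenvalue_one_neighbour:
  assumes k: "k \<ge> 1" and g: "2 * k + 3 = g" and w: "w \<notin> range C" "(w, C s) \<in> E"
    and only: "\<And>d. 2 \<le> d \<Longrightarrow> d \<le> k + 2 \<Longrightarrow> (w, C (s + int d)) \<notin> E"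
  obtains j where "j < m" "j \<noteq> i" "2 * cos (pi / real (k + 2)) \<le> \<nu> j"
proof -
  define p q where "p = (\<lambda>i. if i = 0 then w else C (s + 1 - int i))"
    and "q = (\<lambda>i. C (s + 2 + int i))"
  have p_inj: "inj_on p {..k}"
  proof (rule linorder_inj_onI)
    fix a b assume ab: "a < b" "a \<in> {..k}" "b \<in> {..k}"
    then have eq: "s + 1 - int b + int (b - a) = s + 1 - int a" by simp
    have "C (s + 1 - int b) \<noteq> C (s + 1 - int a)"
      using C_neq[of "b - a" "s + 1 - int b"] ab g unfolding eq by fastforce
    then show "p a \<noteq> p b" using ab w(1) by (auto simp: p_def)
  qed auto
  have q_inj: "inj_on q {..k}"
    using inj_on_subset[OF inj_C[of "s + 2"], of "{..k}"] g by (force simp: q_def)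
  have p_step: "(p a, p (Suc a)) \<in> E" for a
    using w(2) step_back[of "s + 1 - int a"] by (auto simp: p_def algebra_simps)
  have q_step: "(q a, q (Suc a)) \<in> E" for a
    using step[of "s + 2 + int a"] by (auto simp: q_def add_ac)
  obtain y z where "subeigen (2 * cos (pi / real (k + 2))) (p ` {..k}) y"
    "subeigen (2 * cos (pi / real (k + 2))) (q ` {..k}) z"
    using subeigen_path p_inj q_inj p_step q_step k by metis
  moreover have sep: "p a \<noteq> q b \<and> (p a, q b) \<notin> E" if ab: "a \<le> k" "b \<le> k" for a b
  proof (cases "a = 0")
    case True
    then show ?thesis using only[of "b + 2"] w(1) ab by (auto simp: p_def q_def algebra_simps)
  next
    case False
    then have d: "2 \<le> a + b + 1" "a + b + 1 + 2 \<le> g" using ab g by auto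
    have eq: "s + 1 - int a + int (a + b + 1) = s + 2 + int b" by simp
    show ?thesis
      using C_separated[OF d, of "s + 1 - int a"] False unfolding eq by (simp add: p_def q_def)
  qed
  ultimately show ?thesis
    using second_eigenvalue_ge[of _ "p ` {..k}" y "q ` {..k}" z i] two_cos_bounds[OF k] that by blast
qed

text \<open>Here \<open>w\<close> is adjacent to \<open>C (s + 2)\<close>, where the second path
  would begin. So \<open>w\<close> and \<open>C (s + 1)\<close> become the leaves of a fork at
  \<open>C s\<close>, and the path moves on to the offsets 3 to \<open>k + 3\<close>.\<close>

lemma second_eigenvalue_two_neighbours:
  assumes k: "k \<ge> 2" and g: "2 * k + 3 = g" and w: "w \<notin> range C" "(w, C s) \<in> E" "(w, C (s + 2)) \<in> E"
  obtains j where "j < m" "j \<noteq> i" "2 * cos (pi / real (k + 2)) \<le> \<nu> j"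
proof -
  define p q where "p = (\<lambda>i. if i = k then w else C (s + 2 - int k + int i))"
    and "q = (\<lambda>i. C (s + 3 + int i))"
  have p_inj: "inj_on p {..k}"
  proof (rule linorder_inj_onI)
    fix a b assume ab: "a < b" "a \<in> {..k}" "b \<in> {..k}"
    then have eq: "s + 2 - int k + int a + int (b - a) = s + 2 - int k + int b" by simp
    have "C (s + 2 - int k + int a) \<noteq> C (s + 2 - int k + int b)"
      using C_neq[of "b - a" "s + 2 - int k + int a"] ab g unfolding eq by fastforce
    then show "p a \<noteq> p b" using ab w(1) by (auto simp: p_def)
  qed auto
  have q_inj: "inj_on q {..k}"
    using inj_on_subset[OF inj_C[of "s + 3"], of "{..k}"] g by (force simp: q_def)
  have p_step: "(p a, p (Suc a)) \<in> E" if "a + 1 < k" for a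
    using that step[of "s + 2 - int k + int a"] by (auto simp: p_def algebra_simps)
  have p_fork: "(p (k - 2), p k) \<in> E"
    using k w(2) edge_sym by (auto simp: p_def of_nat_diff)
  have q_step: "(q a, q (Suc a)) \<in> E" for a
    using step[of "s + 3 + int a"] by (auto simp: q_def add_ac)
  obtain y where y: "subeigen (2 * cos (pi / real (k + 2))) (p ` {..k}) y"
    using subeigen_fork[OF p_inj k p_step p_fork] by blast
  obtain z where z: "subeigen (2 * cos (pi / real (k + 2))) (q ` {..k}) z"
    using subeigen_path[OF q_inj q_step] k by auto
  have sep: "p a \<noteq> q b \<and> (p a, q b) \<notin> E" if ab: "a \<le> k" "b \<le> k" for a b
  proof (cases "a = k")
    case True
    \<comment> \<open>Such a neighbour has offset \<open>b + 3\<close> from \<open>s\<close> and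
      \<open>b + 1\<close> from \<open>s + 2\<close>. Both must be 0, 2 or \<open>g - 2\<close>,
      which leaves only the even value \<open>g = 6\<close>.\<close>
    have "(w, C (s + int (b + 3))) \<notin> E"
    proof
      assume e: "(w, C (s + int (b + 3))) \<in> E"
      then have e': "(w, C (s + 2 + int (b + 1))) \<in> E" by (simp add: algebra_simps)
      have "b + 3 = 0 \<or> b + 3 = 2 \<or> b + 3 = g - 2" "b + 1 = 0 \<or> b + 1 = 2 \<or> b + 1 = g - 2"
        using C_common_neighbour[OF _ w(2) e] C_common_neighbour[OF _ w(3) e'] ab g k by auto
      then show False using g by presburger
    qed
    then show ?thesis using True w(1) by (auto simp: p_def q_def algebra_simps)
  next
    case False
    then have d: "2 \<le> k + 1 + b - a" "k + 1 + b - a + 2 \<le> g" using ab g by auto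
    have eq: "s + 2 - int k + int a + int (k + 1 + b - a) = s + 3 + int b"
      using ab by (simp add: of_nat_diff)
    show ?thesis
      using C_separated[OF d, of "s + 2 - int k + int a"] False unfolding eq
      by (simp add: p_def q_def)
  qed
  then have "p ` {..k} \<inter> q ` {..k} = {}" "\<And>v w. v \<in> p ` {..k} \<Longrightarrow> w \<in> q ` {..k} \<Longrightarrow> (v, w) \<notin> E"
    by blast+
  moreover have "0 < 2 * cos (pi / real (k + 2))" using two_cos_bounds(1)[of k] k by simp
  ultimately show ?thesis
    using second_eigenvalue_ge[OF y z, of i] that by blast
qed

text \<open>For \<open>k \<ge> 2\<close> the offset \<open>g - 2 = 2 * k + 1\<close> exceeds
  \<open>k + 2\<close>, so a further neighbour of \<open>w\<close> among the offsets 2 to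
  \<open>k + 2\<close> can only be at offset 2.\<close>

lemma second_eigenvalue_attached:
  assumes k: "k \<ge> 2" and g: "2 * k + 3 = g" and w: "w \<notin> range C" "(w, C s) \<in> E"
  obtains j where "j < m" "j \<noteq> i" "2 * cos (pi / real (k + 2)) \<le> \<nu> j"
proof (cases "\<exists>t. (w, C t) \<in> E \<and> (w, C (t + 2)) \<in> E")
  case True
  then show ?thesis using second_eigenvalue_two_neighbours[OF k g w(1)] that by blast
next
  case False
  have "(w, C (s + int d)) \<notin> E" if d: "2 \<le> d" "d \<le> k + 2" for d
  proof
    assume e: "(w, C (s + int d)) \<in> E"
    from C_common_neighbour[OF _ w(2) e] d g k have "d = 2" by auto
    with e w(2) False show False by auto
  qed
  then show ?thesis using second_eigenvalue_one_neighbour[OF _ g w] k that by auto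
qed

text \<open>Without edges leaving \<open>C\<close>, the indicator of \<open>C\<close> is an eigenvector for \<open>2\<close>, hence orthogonal to any
  eigenvector for another eigenvalue.\<close>

lemma isolated_C_second_eigenvalue:
  assumes iso: "\<And>u i. (u, C i) \<in> E \<Longrightarrow> u \<in> range C" and i: "i < m" "\<nu> i \<noteq> 2"
  obtains j where "j < m" "j \<noteq> i" "2 \<le> \<nu> j"
proof -
  define y where "y = (\<lambda>v. of_bool (v \<in> range C) :: real)"
  have e: "(\<Sum>w\<in>V. adj v w * y w) = 2 * y v" if "v \<in> V" for v
    using isolated_C_eigen[OF iso that] by (simp add: y_def)
  have "\<nu> i * (\<Sum>v\<in>V. u i v * y v) = (\<Sum>v\<in>V. (\<nu> i * u i v) * y v)"
    by (simp add: sum_distrib_left mult_ac)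
  also have "\<dots> = (\<Sum>v\<in>V. (\<Sum>w\<in>V. adj v w * u i w) * y v)"
    by (simp add: eigen[OF i(1)])
  also have "\<dots> = (\<Sum>w\<in>V. \<Sum>v\<in>V. adj v w * u i w * y v)"
    unfolding sum_distrib_right by (rule sum.swap)
  also have "\<dots> = (\<Sum>w\<in>V. u i w * (\<Sum>v\<in>V. adj w v * y v))"
    unfolding sum_distrib_left by (intro sum.cong refl) (simp add: adj_sym mult_ac)
  also have "\<dots> = (\<Sum>w\<in>V. u i w * (2 * y w))"
    by (simp add: e)
  also have "\<dots> = 2 * (\<Sum>v\<in>V. u i v * y v)"
    by (simp add: sum_distrib_left mult_ac)
  finally have orth: "(\<Sum>v\<in>V. u i v * y v) = 0" using i(2) by simp
  show ?thesis
    using eigenvalue_ge_of_quad[OF _ subeigen_nsq_pos[OF subeigen_C] subeigen_quad[OF subeigen_C], of "- {i}"]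
      orth that by (auto simp: y_def)
qed

lemma odd_trace_zero: "odd n \<Longrightarrow> n < g \<Longrightarrow> (\<Sum>v\<in>V. walks n v v) = 0"
proof (rule sum.neutral, safe)
  fix v assume "odd n" "n < g" "v \<in> V"
  then show "walks n v v = 0"
    using shortest[of n v] walks_pos_iff[of v n v] walks_nonneg[of n v v] by linarith
qed

lemma odd_trace_pos: "0 < (\<Sum>v\<in>V. walks g v v)"
  using fin C_in C_closed walks_pos_iff[of "C 0" g "C 0"] by (intro sum_pos2[of _ "C 0"]) auto

theorem trace_gt_of_long_odd_girth:
  assumes k: "k \<ge> 2" and g: "2 * k + 3 \<le> g" and i: "i < m" "\<And>l. l < m \<Longrightarrow> \<bar>\<nu> l\<bar> \<le> \<nu> i"
  shows "2 * (\<nu> i ^ (2 * k) + (2 * cos (pi / real (k + 2))) ^ (2 * k)) < (\<Sum>v\<in>V. walks (2 * k) v v)"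
proof -
  define c where "c = 2 * cos (pi / real (k + 2))"
  have c: "0 < c" "c < 2" using two_cos_bounds[of k] k by (auto simp: c_def)
  have second: "2 * (\<nu> i ^ (2 * k) + c ^ (2 * k)) < (\<Sum>v\<in>V. walks (2 * k) v v)"
    if j: "j < m" "j \<noteq> i" "c \<le> \<nu> j" for j
  proof -
    have z: "(\<Sum>l<m. \<nu> l ^ Suc (2 * k)) = 0"
      using odd_trace_zero[of "Suc (2 * k)"] trace_walks[of "Suc (2 * k)"] g by simp
    have "2 * (\<nu> i ^ (2 * k) + c ^ (2 * k)) \<le> (\<Sum>l<m. \<nu> l ^ (2 * k))"
      using even_power_sum_ge_if_odd_power_sum_zero(1)[of "{..<m}" "2 * k" c i j \<nu>] z i j c k by auto
    moreover have "(\<Sum>l<m. \<nu> l ^ (2 * k)) \<noteq> 2 * (\<nu> i ^ (2 * k) + c ^ (2 * k))"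
    proof
      assume "(\<Sum>l<m. \<nu> l ^ (2 * k)) = 2 * (\<nu> i ^ (2 * k) + c ^ (2 * k))"
      then have "(\<Sum>l<m. \<nu> l ^ g) = 0"
        using even_power_sum_ge_if_odd_power_sum_zero(2)[of "{..<m}" "2 * k" c i j \<nu> g] z i j c k odd_g
        by auto
      then show False using odd_trace_pos trace_walks[of g] g_pos by simp
    qed
    ultimately show ?thesis using trace_walks[of "2 * k"] k by simp
  qed
  have "2 * (\<nu> i ^ (2 * k) + c ^ (2 * k)) < (\<Sum>v\<in>V. walks (2 * k) v v)"
  proof (cases "2 * k + 5 \<le> g")
    case True
    then show ?thesis using second_eigenvalue_long_cycle[of k i] second k by (auto simp: c_def)
  next
    case False
    then have g: "2 * k + 3 = g" using g odd_g by (cases "g = 2 * k + 4") auto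
    show ?thesis
    proof (cases "\<exists>w s. w \<notin> range C \<and> (w, C s) \<in> E")
      case True
      then show ?thesis using second_eigenvalue_attached[OF k g, of _ _ i] second by (auto simp: c_def)
    next
      case iso: False
      show ?thesis
      proof (cases "\<nu> i = 2")
        case True
        then show ?thesis
          using trace_ge_binomial[of k] central_binomial_gap[OF k] g by (simp add: c_def)
      next
        case False
        then obtain j where "j < m" "j \<noteq> i" "2 \<le> \<nu> j"
          using isolated_C_second_eigenvalue[OF _ i(1)] iso by blast
        then show ?thesis using second[of j] c by simp
      qed
    qed
  qed
  then show ?thesis by (simp add: c_def)
qed

end

section \<open>Triangle-free graphs\<close>

context shortest_odd_cycle
begin

definition nbrs :: "'v \<Rightarrow> 'v set" where
  "nbrs v = {w. (v, w) \<in> E}"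

text \<open>An edge avoiding the neighbourhood of \<open>v\<close> counts twice, in accordance with
  \<open>card E\<close>.\<close>

definition far_arcs :: "'v \<Rightarrow> 'v rel" where
  "far_arcs v = {(p, q) \<in> E. p \<notin> nbrs v \<and> q \<notin> nbrs v}"

lemma nbrs_sub: "nbrs v \<subseteq> V"
  using edge_in by (auto simp: nbrs_def)

lemma fin_nbrs [simp]: "finite (nbrs v)"
  using fin nbrs_sub finite_subset by blast

lemma fin_far_arcs [simp]: "finite (far_arcs v)"
  using finE by (rule finite_subset[rotated]) (auto simp: far_arcs_def)

lemma sum_adj: "(\<Sum>w\<in>V. adj v w * f w) = (\<Sum>w\<in>nbrs v. f w)"
proof -
  have "(\<Sum>w\<in>nbrs v. f w) = (\<Sum>w\<in>nbrs v. adj v w * f w)"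
    by (intro sum.cong) (auto simp: nbrs_def adj_def)
  also have "\<dots> = (\<Sum>w\<in>V. adj v w * f w)"
    using fin nbrs_sub by (intro sum.mono_neutral_left) (auto simp: nbrs_def adj_def)
  finally show ?thesis by simp
qed

lemma nbrs_independent:
  assumes "5 \<le> g" "p \<in> nbrs v" "q \<in> nbrs v"
  shows "(p, q) \<notin> E"
proof
  assume "(p, q) \<in> E"
  then have "(v, v) \<in> E ^^ 3"
    using assms edge_sym by (auto simp: nbrs_def numeral_3_eq_3)
  then show False using shortest[of 3 v] assms(1) by simp
qed

text \<open>The neighbourhood of \<open>v\<close> is independent, so an edge meeting it has exactly
  one end there and accounts for two arcs. The sum of degrees is the row sum of the squared
  adjacency matrix at \<open>v\<close>.\<close>

lemma card_arcs_split:
  assumes "5 \<le> g"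
  shows "card E = 2 * (\<Sum>p\<in>nbrs v. card (nbrs p)) + card (far_arcs v)"
proof -
  define X where "X = Sigma (nbrs v) nbrs"
  have cX: "card X = (\<Sum>p\<in>nbrs v. card (nbrs p))" "finite X" by (auto simp: X_def)
  have disj: "X \<inter> X\<inverse> = {}"
  proof (rule equals0I)
    fix e assume "e \<in> X \<inter> X\<inverse>"
    then obtain p q where "p \<in> nbrs v" "q \<in> nbrs v" "q \<in> nbrs p" by (auto simp: X_def)
    then show False using nbrs_independent[OF assms, of p v q] by (simp add: nbrs_def)
  qed
  have disj': "(X \<union> X\<inverse>) \<inter> far_arcs v = {}"
    unfolding X_def far_arcs_def by blast
  have "E = (X \<union> X\<inverse>) \<union> far_arcs v"
    using edge_sym by (auto simp: X_def far_arcs_def nbrs_def)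
  then have "card E = card ((X \<union> X\<inverse>) \<union> far_arcs v)" by simp
  also have "\<dots> = card (X \<union> X\<inverse>) + card (far_arcs v)"
    using cX(2) disj' by (intro card_Un_disjoint fin_far_arcs) simp_all
  also have "card (X \<union> X\<inverse>) = card X + card (X\<inverse>)"
    using cX(2) disj by (intro card_Un_disjoint) simp_all
  finally show ?thesis using cX by simp
qed

text \<open>Otherwise membership in the independent neighbourhood would alternate along
  \<open>C\<close>, against its odd length.\<close>

lemma far_step:
  assumes "5 \<le> g"
  obtains i where "C i \<notin> nbrs v" "C (i + 1) \<notin> nbrs v"
proof (rule ccontr)
  assume no: "\<not> thesis"
  have alt: "C (i + 1) \<in> nbrs v \<longleftrightarrow> C i \<notin> nbrs v" for i
    using no that nbrs_independent[OF assms, of "C i" v "C (i + 1)"] step by blast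
  have "C (0 + int n) \<in> nbrs v \<longleftrightarrow> (C 0 \<in> nbrs v \<longleftrightarrow> even n)" for n
  proof (induction n)
    case (Suc n)
    then show ?case using alt[of "int n"] by (simp add: add.commute)
  qed simp
  from this[of g] show False using period[of 0] odd_g by simp
qed

lemma far_arcs_ge_2:
  assumes "5 \<le> g"
  obtains i where "{(C i, C (i + 1)), (C (i + 1), C i)} \<subseteq> far_arcs v" "2 \<le> card (far_arcs v)"
proof -
  obtain i where i: "C i \<notin> nbrs v" "C (i + 1) \<notin> nbrs v" using far_step[OF assms] .
  then have sub: "{(C i, C (i + 1)), (C (i + 1), C i)} \<subseteq> far_arcs v"
    using step[of i] edge_sym by (auto simp: far_arcs_def)
  moreover have "C i \<noteq> C (i + 1)" using step[of i] no_loop by metis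
  then have "card {(C i, C (i + 1)), (C (i + 1), C i)} = 2" by simp
  then have "2 \<le> card (far_arcs v)" using card_mono[OF fin_far_arcs sub] by simp
  ultimately show ?thesis by (rule that)
qed

text \<open>The eigenvector equation, applied twice, writes \<open>L\<^sup>2\<close> as the sum of
  \<open>x q / x v\<close> over two-step walks from \<open>v\<close>. By maximality no ratio exceeds
  1, and equality makes all of them 1.\<close>

lemma squared_eigenvalue_le:
  assumes ev: "\<And>v. v \<in> V \<Longrightarrow> (\<Sum>w\<in>V. adj v w * x w) = L * x v"
    and v: "v \<in> V" "x v \<noteq> 0" and mx: "\<And>w. w \<in> V \<Longrightarrow> \<bar>x w\<bar> \<le> \<bar>x v\<bar>"
  shows "L\<^sup>2 \<le> (\<Sum>p\<in>nbrs v. card (nbrs p))"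
    and "L\<^sup>2 = (\<Sum>p\<in>nbrs v. card (nbrs p)) \<Longrightarrow> p \<in> nbrs v \<Longrightarrow> q \<in> nbrs p \<Longrightarrow> x q = x v"
proof -
  define S where "S = (\<Sum>p\<in>nbrs v. card (nbrs p))"
  define y where "y = (\<lambda>w. x w / x v)"
  have y1: "y q \<le> 1" if "q \<in> nbrs p" for p q
  proof -
    have "\<bar>y q\<bar> \<le> 1" using mx[of q] that nbrs_sub v by (auto simp: y_def)
    then show ?thesis by simp
  qed
  have "L\<^sup>2 * x v = L * (\<Sum>p\<in>nbrs v. x p)"
    using ev[OF v(1)] by (simp add: sum_adj power2_eq_square)
  also have "\<dots> = (\<Sum>p\<in>nbrs v. \<Sum>q\<in>nbrs p. x q)"
    unfolding sum_distrib_left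
  proof (rule sum.cong[OF refl])
    fix p assume "p \<in> nbrs v"
    then have "p \<in> V" using nbrs_sub by blast
    from ev[OF this] show "L * x p = (\<Sum>q\<in>nbrs p. x q)" by (simp add: sum_adj)
  qed
  finally have L2: "L\<^sup>2 = (\<Sum>p\<in>nbrs v. \<Sum>q\<in>nbrs p. y q)"
    using v(2) by (simp add: y_def field_simps flip: sum_divide_distrib)
  have inner: "(\<Sum>q\<in>nbrs p. y q) \<le> real (card (nbrs p))" for p
    using sum_mono[of "nbrs p" y "\<lambda>_. 1"] y1 by simp
  have "L\<^sup>2 \<le> (\<Sum>p\<in>nbrs v. real (card (nbrs p)))"
    unfolding L2 by (intro sum_mono inner)
  then show "L\<^sup>2 \<le> (\<Sum>p\<in>nbrs v. card (nbrs p))" by simp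
  show "x q = x v" if eq: "L\<^sup>2 = (\<Sum>p\<in>nbrs v. card (nbrs p))" and p: "p \<in> nbrs v" and q: "q \<in> nbrs p"
  proof (rule ccontr)
    assume "x q \<noteq> x v"
    then have "y q < 1" using y1[OF q] v(2) by (auto simp: y_def less_le)
    then have "(\<Sum>q\<in>nbrs p. y q) < (\<Sum>q\<in>nbrs p. 1)"
      using y1 q by (intro sum_strict_mono_ex1) auto
    then have "L\<^sup>2 < (\<Sum>p\<in>nbrs v. real (card (nbrs p)))"
      unfolding L2 using p inner by (intro sum_strict_mono_ex1) auto
    then show False using eq by simp
  qed
qed

text \<open>In the case of equality the eigenvector is constant on the component \<open>K\<close> of a vertex \<open>v\<close> where
  its modulus is maximal, so \<open>K\<close> is \<open>d\<close>-regular with \<open>d = L\<close> and contains all edges. Then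
  \<open>2 * d\<^sup>2 + 2 = card K * d\<close> forces \<open>d\<close> to divide \<open>2\<close>.\<close>

theorem triangle_free_bound:
  assumes g: "5 \<le> g" and ev: "\<And>v. v \<in> V \<Longrightarrow> (\<Sum>w\<in>V. adj v w * x w) = L * x v"
    and nz: "\<exists>v\<in>V. x v \<noteq> 0"
  shows "2 * L\<^sup>2 + 2 \<le> card E" and "2 * L\<^sup>2 + 2 = card E \<Longrightarrow> L\<^sup>2 = 4"
proof -
  have "Max ((\<lambda>v. \<bar>x v\<bar>) ` V) \<in> (\<lambda>v. \<bar>x v\<bar>) ` V" using fin nz by (intro Max_in) auto
  then obtain v where v: "v \<in> V" "\<bar>x v\<bar> = Max ((\<lambda>v. \<bar>x v\<bar>) ` V)" by force
  have mx: "\<bar>x w\<bar> \<le> \<bar>x v\<bar>" if "w \<in> V" for w unfolding v(2) using that fin by (intro Max_ge) auto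
  have v0: "x v \<noteq> 0" using nz mx by fastforce
  \<comment> \<open>A vertex with the value \<open>x v\<close> is maximal as well, so the equality
    case propagates from \<open>v\<close> along walks of even length.\<close>
  have bound: "2 * L\<^sup>2 + card (far_arcs w) \<le> card E"
    "2 * L\<^sup>2 + 2 = card E \<Longrightarrow> p \<in> nbrs w \<Longrightarrow> q \<in> nbrs p \<Longrightarrow> x q = x v"
    if w: "w \<in> V" "x w = x v" for w p q
  proof -
    have mw: "\<And>z. z \<in> V \<Longrightarrow> \<bar>x z\<bar> \<le> \<bar>x w\<bar>" using mx w by simp
    have w0: "x w \<noteq> 0" using v0 w by simp
    have le: "L\<^sup>2 \<le> (\<Sum>p\<in>nbrs w. card (nbrs p))"
      using squared_eigenvalue_le(1)[of x L w] ev w(1) w0 mw by blast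
    have cE: "real (card E) = 2 * real (\<Sum>p\<in>nbrs w. card (nbrs p)) + real (card (far_arcs w))"
      using card_arcs_split[OF g, of w] by linarith
    show "2 * L\<^sup>2 + card (far_arcs w) \<le> card E" using le cE by linarith
    assume "2 * L\<^sup>2 + 2 = card E" and pq: "p \<in> nbrs w" "q \<in> nbrs p"
    moreover obtain i where "2 \<le> card (far_arcs w)" using far_arcs_ge_2[OF g] .
    ultimately have "L\<^sup>2 = (\<Sum>p\<in>nbrs w. card (nbrs p))" using le cE by linarith
    then show "x q = x v"
      using squared_eigenvalue_le(2)[of x L w p q] ev w w0 mw pq by metis
  qed
  obtain i where far: "{(C i, C (i + 1)), (C (i + 1), C i)} \<subseteq> far_arcs v" "2 \<le> card (far_arcs v)"
    using far_arcs_ge_2[OF g] .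
  show "2 * L\<^sup>2 + 2 \<le> card E" using bound(1)[OF v(1) refl] far(2) by linarith
  show "L\<^sup>2 = 4" if eq: "2 * L\<^sup>2 + 2 = card E"
  proof -
    have even_walk: "(v, w) \<in> E ^^ (2 * r) \<Longrightarrow> w \<in> V \<and> x w = x v" for r w
    proof (induction r arbitrary: w)
      case (Suc r)
      then obtain z p where "(v, z) \<in> E ^^ (2 * r)" "p \<in> nbrs z" "w \<in> nbrs p"
        by (auto simp: nbrs_def)
      then show ?case using Suc.IH[of z] bound(2)[of z p w] eq nbrs_sub by blast
    qed (use v in simp)
    have "card (far_arcs v) = 2" using bound(1)[OF v(1) refl] far(2) eq by linarith
    moreover have "C i \<noteq> C (i + 1)" using step[of i] no_loop by metis
    ultimately have far_eq: "far_arcs v = {(C i, C (i + 1)), (C (i + 1), C i)}"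
      using card_subset_eq[OF fin_far_arcs far(1)] by simp
    \<comment> \<open>If \<open>C\<close> avoided the neighbourhood, all its
      \<open>g \<ge> 5\<close> forward arcs would be far, but only two arcs are. This places
      \<open>C\<close> in the component of \<open>v\<close>.\<close>
    obtain s where s: "C s \<in> nbrs v"
    proof (rule ccontr)
      assume no: "\<not> thesis"
      have "(C j, C (j + 1)) \<in> far_arcs v" for j
        using no that step by (auto simp: far_arcs_def)
      then have sub: "(\<lambda>j. (C (0 + int j), C (0 + int j + 1))) ` {..<g} \<subseteq> far_arcs v" by auto
      have "inj_on (\<lambda>j. (C (0 + int j), C (0 + int j + 1))) {..<g}"
        using inj_C[of 0] by (auto simp: inj_on_def)
      from card_image[OF this] card_mono[OF fin_far_arcs sub] \<open>card (far_arcs v) = 2\<close> g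
      show False by simp
    qed
    define K where "K = {w. \<exists>n. (v, w) \<in> E ^^ n}"
    \<comment> \<open>Going to \<open>C\<close>, once around it and back is an odd closed walk. It
      corrects parities, so even walks reach the whole component.\<close>
    have odd_closed: "(v, v) \<in> E ^^ (1 + g + 1)"
    proof -
      have "(v, C s) \<in> E ^^ 1" "(C s, v) \<in> E ^^ 1" using s edge_sym by (auto simp: nbrs_def)
      then show ?thesis using relpow_trans C_closed by metis
    qed
    have K: "w \<in> V \<and> x w = x v" if wK: "w \<in> K" for w
    proof -
      obtain n where n: "(v, w) \<in> E ^^ n" using wK by (auto simp: K_def)
      obtain n' where "(v, w) \<in> E ^^ n'" "even n'"
      proof (cases "even n")
        case False
        then show ?thesis using that[OF relpow_trans[OF odd_closed n]] odd_g by simp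
      qed (use n that in blast)
      then show ?thesis using even_walk by (auto elim!: evenE)
    qed
    have K_step: "q \<in> K" if pq: "p \<in> K" "(p, q) \<in> E" for p q
    proof -
      obtain n where "(v, p) \<in> E ^^ n" using pq by (auto simp: K_def)
      then have "(v, q) \<in> E ^^ Suc n" using pq by auto
      then show ?thesis unfolding K_def by blast
    qed
    have vK: "v \<in> K" unfolding K_def by (auto intro!: exI[of _ 0])
    have CK: "C j \<in> K" for j
    proof -
      obtain d where d: "C j = C (s + int d)" using C_offset[of j s] by metis
      have "(v, C s) \<in> E ^^ 1" using s by (simp add: nbrs_def)
      from relpow_trans[OF this C_walk[of s d]] show ?thesis unfolding K_def d by blast
    qed
    have deg: "L = card (nbrs w)" if "w \<in> K" for w
    proof -
      have "(\<Sum>z\<in>nbrs w. x z) = (\<Sum>z\<in>nbrs w. x v)"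
        using K K_step that by (intro sum.cong) (auto simp: nbrs_def)
      then have "L * x v = card (nbrs w) * x v"
        using ev[of w] K[OF that] by (auto simp: sum_adj)
      then show ?thesis using v0 by simp
    qed
    define d where "d = card (nbrs v)"
    have degd: "card (nbrs w) = d" if "w \<in> K" for w
      using deg[OF that] deg[OF vK] by (simp add: d_def)
    \<comment> \<open>An edge avoiding the neighbourhood of \<open>v\<close> is the one far edge,
      which belongs to \<open>C\<close>.\<close>
    have "p \<in> K" if pq: "(p, q) \<in> E" for p q
    proof -
      consider "p \<in> nbrs v" | "q \<in> nbrs v" | "(p, q) \<in> far_arcs v"
        using pq by (auto simp: far_arcs_def)
      then show ?thesis
      proof cases
        case 1
        then show ?thesis using K_step[OF vK] by (simp add: nbrs_def)
      next
        case 2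
        then show ?thesis using K_step[OF vK] K_step edge_sym[OF pq] by (auto simp: nbrs_def)
      next
        case 3
        then show ?thesis using CK by (auto simp: far_eq)
      qed
    qed
    then have "E = Sigma K nbrs" by (auto simp: nbrs_def)
    then have "card E = card (Sigma K nbrs)" by (rule arg_cong)
    moreover have "finite K" using K fin by (auto intro: finite_subset)
    ultimately have cE: "card E = card K * d" by (simp add: degd)
    have Ld: "L = real d" using deg[OF vK] by (simp add: d_def)
    have "real (2 * d\<^sup>2 + 2) = real (card K * d)" using eq unfolding cE Ld by simp
    then have e: "2 * d\<^sup>2 + 2 = card K * d" by (simp only: of_nat_eq_iff)
    have "d dvd 2 * d\<^sup>2 + 2" unfolding e by simp
    moreover have "d dvd 2 * d\<^sup>2" by (simp add: power2_eq_square)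
    ultimately have "d dvd 2" by (metis dvd_add_right_iff)
    then have "d \<le> 2" by (intro dvd_imp_le) auto
    moreover have "2 \<le> d"
    proof -
      have "{C (0 - 1), C (0 + 1)} \<subseteq> nbrs (C 0)"
        using step[of 0] step_back[of 0] by (auto simp: nbrs_def)
      from card_mono[OF fin_nbrs this] C_pred_succ[of 0] degd[OF CK[of 0]] show ?thesis by simp
    qed
    ultimately have "d = 2" by simp
    then show "L\<^sup>2 = 4" by (simp add: Ld)
  qed
qed

text \<open>\<open>C\<close> alone carries \<open>2 * g \<ge> 10\<close> arcs, so it is a five-cycle
  and exhausts the edges.\<close>

lemma arcs_of_card_10:
  assumes "5 \<le> g" "card E = 10"
  shows "g = 5" and "E \<subseteq> range C \<times> range C"
proof -
  define A where "A = Sigma (range C) (\<lambda>c. nbrs c \<inter> range C)"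
  have sub: "A \<subseteq> E" by (auto simp: A_def nbrs_def)
  have cR: "card (range C) = g" "finite (range C)"
    using card_image[OF inj_C[of 0]] range_C[of 0] by simp_all
  have "nbrs (C j) \<inter> range C = {C (j - 1), C (j + 1)}" for j
    using neighbours_in_C[of j] step[of j] step_back[of j] by (auto simp: nbrs_def)
  then have c2: "card (nbrs (C j) \<inter> range C) = 2" for j using C_pred_succ[of j] by simp
  have "card A = (\<Sum>c\<in>range C. card (nbrs c \<inter> range C))"
    unfolding A_def using cR by (intro card_SigmaI) auto
  also have "\<dots> = (\<Sum>c\<in>range C. 2)" by (intro sum.cong refl) (use c2 in auto)
  finally have cA: "card A = 2 * g" using cR by simp
  then show "g = 5" using card_mono[OF finE sub] assms by simp
  then have "A = E" using card_subset_eq[OF finE sub] cA assms by simp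
  then show "E \<subseteq> range C \<times> range C" by (auto simp: A_def)
qed

end

section \<open>Adjacency matrices and graph isomorphisms\<close>

context edge_relation
begin

lemma sum_over_list:
  assumes "distinct vs" "set vs = V"
  shows "(\<Sum>v\<in>V. f v) = (\<Sum>i<length vs. f (vs ! i))"
  using sum.reindex_bij_betw[OF bij_betw_nth[OF assms(1) refl], of V f] assms(2)
  by simp

lemma spectral_decomposition_exists:
  obtains m u \<nu> where "spectral_edge_relation V E m u \<nu>"
proof (rule symmetric_spectral_decomposition[OF fin, of adj])
  fix m u \<nu>
  assume "orthonormal_family V m u"
    and "\<And>v w. v \<in> V \<Longrightarrow> w \<in> V \<Longrightarrow> adj v w = (\<Sum>l<m. \<nu> l * u l v * u l w)"
  then have "spectral_edge_relation V E m u \<nu>" by unfold_locales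
  then show thesis by (rule that)
qed (rule adj_sym)

text \<open>Vertices are coloured by the parity of a walk from a root of their component. Without
  odd closed walks the colour is well defined and changes along every edge.\<close>

lemma odd_closed_walk_of_not_bipartite:
  assumes nb: "\<not> (\<exists>U W. V = U \<union> W \<and> U \<inter> W = {} \<and> E \<subseteq> U \<times> W \<union> W \<times> U)"
  obtains n v where "odd n" "(v, v) \<in> E ^^ n"
proof (rule ccontr)
  assume no: "\<not> thesis"
  have even_closed: "even n" if "(v, v) \<in> E ^^ n" for v n
    using no that \<open>\<And>n v. odd n \<Longrightarrow> (v, v) \<in> E ^^ n \<Longrightarrow> thesis\<close> by blast
  \<comment> \<open>The predicate is the same for adjacent vertices, so \<open>SOME\<close> picks
    one root per component.\<close>
  define root where "root = (\<lambda>v. SOME w. \<exists>n. (w, v) \<in> E ^^ n)"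
  have root: "\<exists>n. (root v, v) \<in> E ^^ n" for v
  proof -
    have "\<exists>n. (v, v) \<in> E ^^ n" by (rule exI[of _ 0]) simp
    then show ?thesis unfolding root_def by (rule someI)
  qed
  have root_eq: "root p = root q" if pq: "(p, q) \<in> E" for p q
  proof -
    have "(\<exists>n. (w, p) \<in> E ^^ n) \<longleftrightarrow> (\<exists>n. (w, q) \<in> E ^^ n)" for w
      using relpow_Suc_I[of w p _ E q] relpow_Suc_I[of w q _ E p] pq edge_sym[OF pq] by blast
    then show ?thesis unfolding root_def by simp
  qed
  define U where "U = {v \<in> V. \<exists>n. even n \<and> (root v, v) \<in> E ^^ n}"
  have parity: "even (i + j + 1)" if "(p, q) \<in> E" "(root p, p) \<in> E ^^ i" "(root q, q) \<in> E ^^ j" for p q i j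
  proof -
    have "(root p, q) \<in> E ^^ Suc i" using that relpow_Suc_I by metis
    from relpow_trans[OF this relpow_sym[OF that(3)]] root_eq[OF that(1)]
    have "(root p, root p) \<in> E ^^ (Suc i + j)" by simp
    then show ?thesis using even_closed by fastforce
  qed
  have "(p, q) \<in> U \<times> (V - U) \<union> (V - U) \<times> U" if pq: "(p, q) \<in> E" for p q
  proof -
    obtain i j where ij: "(root p, p) \<in> E ^^ i" "(root q, q) \<in> E ^^ j" using root by blast
    have "even i' = even i" if "(root p, p) \<in> E ^^ i'" for i'
      using parity[OF pq that ij(2)] parity[OF pq ij] by auto
    moreover have "even j' = even j" if "(root q, q) \<in> E ^^ j'" for j'
      using parity[OF pq ij(1) that] parity[OF pq ij] by auto
    ultimately have U_iff: "p \<in> U \<longleftrightarrow> even i" "q \<in> U \<longleftrightarrow> even j"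
      using ij edge_in[OF pq] unfolding U_def by blast+
    then show ?thesis using parity[OF pq ij] edge_in[OF pq] by auto
  qed
  then have "E \<subseteq> U \<times> (V - U) \<union> (V - U) \<times> U" by auto
  moreover have "V = U \<union> (V - U)" by (auto simp: U_def)
  ultimately show False using nb by blast
qed

text \<open>A shortest odd closed walk, wound periodically around the integers.\<close>

lemma shortest_odd_cycle_exists:
  assumes "\<not> (\<exists>U W. V = U \<union> W \<and> U \<inter> W = {} \<and> E \<subseteq> U \<times> W \<union> W \<times> U)"
  obtains g C where "shortest_odd_cycle V E g C"
proof -
  define P where "P = (\<lambda>n. odd n \<and> (\<exists>v. (v, v) \<in> E ^^ n))"
  define g where "g = (LEAST n. P n)"
  obtain n v where "odd n" "(v, v) \<in> E ^^ n" using odd_closed_walk_of_not_bipartite[OF assms] .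
  then have "P n" unfolding P_def by blast
  then have "P g" unfolding g_def by (rule LeastI)
  then obtain v where g: "odd g" "(v, v) \<in> E ^^ g" by (auto simp: P_def)
  then obtain f where f: "f 0 = v" "f g = v" "\<And>i. i < g \<Longrightarrow> (f i, f (Suc i)) \<in> E"
    unfolding relpow_fun_conv by blast
  have g0: "0 < g" using g odd_pos by blast
  define C where "C = (\<lambda>i. f (nat (i mod int g)))"
  have "(C i, C (i + 1)) \<in> E" for i
  proof -
    define r where "r = nat (i mod int g)"
    have r: "r < g" "i mod int g = int r" using g0 by (auto simp: r_def nat_less_iff)
    have "(i + 1) mod int g = (int r + 1) mod int g" by (simp add: mod_add_left_eq flip: r(2))
    also have "\<dots> = int (Suc r mod g)" by (simp add: zmod_int add.commute)
    finally have "C (i + 1) = f (Suc r mod g)" by (simp add: C_def)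
    also have "\<dots> = f (Suc r)" using r(1) f by (cases "Suc r = g") auto
    finally have "C (i + 1) = f (Suc r)" .
    moreover have "C i = f r" by (simp add: C_def r(2))
    ultimately show ?thesis using f(3)[OF r(1)] by simp
  qed
  moreover have "g \<le> n" if "odd n" "(w, w) \<in> E ^^ n" for n w
    unfolding g_def using that by (intro Least_le) (auto simp: P_def)
  ultimately have "shortest_odd_cycle V E g C"
    using g(1) by unfold_locales (auto simp: C_def)
  then show ?thesis by (rule that)
qed

end

section \<open>Digraph isomorphisms and the five-cycle\<close>

lemma digraph_iso_pairI:
  assumes "pair_wf_digraph F" "inj_on f (pverts F)" "f ` pverts F = pverts H"
    and "map_prod f f ` parcs F = parcs H"
  shows "digraph_iso (with_proj F) (with_proj H)"
proof -
  interpret pair_wf_digraph F by fact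
  define hom where "hom = \<lparr>iso_verts = f, iso_arcs = map_prod f f, iso_head = snd, iso_tail = fst\<rparr>"
  have "inj_on (map_prod f f) (parcs F)"
    using map_prod_inj_on[OF assms(2) assms(2)] by (rule inj_on_subset) (auto dest: in_arcsD1 in_arcsD2)
  then have "pre_digraph.digraph_isomorphism (with_proj F) hom"
    using assms(2) wf_digraph_axioms by (simp add: pre_digraph.digraph_isomorphism_def hom_def)
  moreover have "with_proj H = app_iso hom (with_proj F)"
    using assms(3,4) by (simp add: app_iso_def hom_def with_proj_def)
  ultimately show ?thesis unfolding digraph_iso_def by blast
qed

lemma digraph_iso_card_arcs: "digraph_iso F H \<Longrightarrow> card (arcs H) = card (arcs F)"
  unfolding digraph_iso_def pre_digraph.digraph_isomorphism_def by (auto simp: card_image)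

lemma pair_wf_cycle_graph: "pair_wf_digraph (cycle_graph n)"
  by unfold_locales (auto simp: cycle_graph_def)

lemma card_arcs_C5: "card (parcs (cycle_graph 5)) = 10"
proof -
  have "parcs (cycle_graph 5) = (\<lambda>i. (i, Suc i mod 5)) ` {..<5} \<union> (\<lambda>i. (Suc i mod 5, i)) ` {..<5}"
    by (auto simp: cycle_graph_def)
  also have "{..<5} = {0, 1, 2, 3, 4 :: nat}" by (simp add: lessThan_nat_numeral lessThan_Suc insert_commute)
  finally show ?thesis by simp
qed

lemma edge_relation_of_pair_graph:
  assumes "pair_graph G"
  shows "edge_relation (pverts G) (parcs G)"
proof -
  interpret pair_graph G by fact
  show ?thesis
  proof
    show "sym (parcs G)" using pair_sym_arcs by (simp add: symmetric_def)
    show "irrefl (parcs G)" using pair_no_loops by (force simp: irrefl_def)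
  qed (use pair_finite_verts in_arcsD1 in_arcsD2 in auto)
qed

text \<open>Turns the forbidden odd cycles into a lower bound on \<open>g\<close>.\<close>

lemma contains_shortest_odd_cycle:
  assumes G: "pair_graph G" and C: "shortest_odd_cycle (pverts G) (parcs G) g C"
  shows "contains_subgraph G (cycle_graph g)"
proof -
  interpret shortest_odd_cycle "pverts G" "parcs G" g C by fact
  interpret P: pair_graph G by fact
  define f where "f = (\<lambda>i. C (int i))"
  define H where "H = \<lparr>pverts = f ` pverts (cycle_graph g), parcs = map_prod f f ` parcs (cycle_graph g)\<rparr>"
  have inj: "inj_on f (pverts (cycle_graph g))"
    using inj_C[of 0] by (simp add: f_def cycle_graph_def)
  have f_Suc: "f (Suc i mod g) = C (int i + 1)" for i
  proof -
    have "int i + 1 = int (Suc i mod g) + int g * int (Suc i div g)"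
      by (simp flip: of_nat_mult of_nat_add add: add.commute)
    then show ?thesis using C_mod by (simp add: f_def)
  qed
  have arcs: "parcs H \<subseteq> parcs G"
    using step edge_sym f_Suc by (auto simp: H_def cycle_graph_def) (auto simp: f_def)
  have wfH: "pair_wf_digraph H"
    by unfold_locales (auto simp: H_def cycle_graph_def)
  then interpret H: pair_wf_digraph H .
  have "digraph_iso (with_proj (cycle_graph g)) (with_proj H)"
    by (rule digraph_iso_pairI[OF pair_wf_cycle_graph inj]) (simp_all add: H_def)
  moreover have "subgraph (with_proj H) (with_proj G)"
  proof (rule subgraphI)
    show "verts (with_proj H) \<subseteq> verts (with_proj G)"
      using C_in by (auto simp: H_def f_def)
    show "compatible (with_proj G) (with_proj H)" by (simp add: compatible_def)
  qed (use arcs H.wf_digraph_axioms P.wf_digraph_axioms in auto)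
  ultimately show ?thesis unfolding contains_subgraph_def by blast
qed

text \<open>Vertices of \<open>C\<close> go to their index; the others meet no arc and are numbered
  arbitrarily.\<close>

lemma iso_C5_with_isolated_vertices:
  assumes G: "pair_graph G" and C: "shortest_odd_cycle (pverts G) (parcs G) 5 C"
    and arcs_C: "parcs G \<subseteq> range C \<times> range C"
  shows "\<exists>s. digraph_iso (with_proj G) (with_proj (add_isolated s (cycle_graph 5)))"
proof -
  interpret shortest_odd_cycle "pverts G" "parcs G" 5 C by fact
  interpret P: pair_graph G by fact
  define R where "R = pverts G - range C"
  obtain h where h: "bij_betw h R {..<card R}"
    using fin ex_bij_betw_finite_nat[of R] by (auto simp: R_def atLeast0LessThan)
  define c where "c = (\<lambda>i. C (int i))"
  have bc: "bij_betw c {..<5} (range C)"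
    using inj_C[of 0] range_C[of 0] by (simp add: bij_betw_def c_def)
  define idx where "idx = the_inv_into {..<5} c"
  have idx: "bij_betw idx (range C) {..<5}" unfolding idx_def by (rule bij_betw_the_inv_into[OF bc])
  have idx_c: "idx (c i) = i" if "i < 5" for i
    unfolding idx_def using bc that by (intro the_inv_into_f_f) (auto simp: bij_betw_def)
  define f where "f = (\<lambda>v. if v \<in> range C then Inl (idx v) else Inr (h v))"
  have V: "pverts G = range C \<union> R" using C_in by (auto simp: R_def)
  have "inj_on f (pverts G)"
  proof (rule inj_onI)
    fix p q assume pq: "p \<in> pverts G" "q \<in> pverts G" "f p = f q"
    show "p = q"
    proof (cases "p \<in> range C")
      case True
      then have "q \<in> range C" "idx p = idx q" using pq by (auto simp: f_def split: if_splits)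
      then show ?thesis using True inj_onD[OF bij_betw_imp_inj_on[OF idx]] by blast
    next
      case False
      then have "q \<notin> range C" "h p = h q" using pq by (auto simp: f_def split: if_splits)
      then show ?thesis using False pq inj_onD[OF bij_betw_imp_inj_on[OF h], of p q]
        by (simp add: R_def)
    qed
  qed
  moreover have "f ` pverts G = pverts (add_isolated (card R) (cycle_graph 5))"
  proof -
    have "f ` range C = Inl ` {..<5}"
      using bij_betw_imp_surj_on[OF idx] by (auto simp: f_def image_iff)
    moreover have "f ` R = Inr ` {..<card R}"
      using bij_betw_imp_surj_on[OF h] by (auto simp: f_def R_def image_iff)
    ultimately show ?thesis
      unfolding V by (simp add: image_Un add_isolated_def cycle_graph_def Plus_def)
  qed
  moreover have "map_prod f f ` parcs G = parcs (add_isolated (card R) (cycle_graph 5))"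
  proof -
    have adj_iff: "(c i, c j) \<in> parcs G \<longleftrightarrow> (i, j) \<in> parcs (cycle_graph 5)" if "i < 5" "j < 5" for i j
    proof -
      have le: "(c i, c j) \<in> parcs G \<longleftrightarrow> (i, j) \<in> parcs (cycle_graph 5)" if ij: "i < j" "j < 5" for i j
      proof -
        have c_eqs: "c i = C (int i)" "c j = C (int i + int (j - i))" using ij by (simp_all add: c_def)
        have C_edge: "(C (int i), C (int i + int d)) \<in> parcs G \<longleftrightarrow> d = 1 \<or> d = 4" if "d < 5" for d
        proof -
          have "(C (int i), C (int i + 4)) \<in> parcs G"
            using step_back[of "int i"] period[of "int i - 1"] by (simp add: add.commute)
          then show ?thesis using C_adjacent[of d "int i"] step[of "int i"] that by auto
        qed
        have cycle_edge: "j - i = 1 \<or> j - i = 4 \<longleftrightarrow> (i, j) \<in> parcs (cycle_graph 5)"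
        proof -
          have "Suc i mod 5 = Suc i" "Suc j mod 5 = (if j = 4 then 0 else Suc j)" using ij by auto
          then have edge_iff: "(i, j) \<in> parcs (cycle_graph 5) \<longleftrightarrow> j = Suc i \<or> i = (if j = 4 then 0 else Suc j)"
            using ij by (simp add: cycle_graph_def)
          show ?thesis unfolding edge_iff using ij by (cases "j = 4") (simp_all, arith+)
        qed
        show ?thesis
          unfolding c_eqs cycle_edge[symmetric] by (rule C_edge) (use ij in simp)
      qed
      have swap: "(i, j) \<in> parcs (cycle_graph 5) \<longleftrightarrow> (j, i) \<in> parcs (cycle_graph 5)"
        by (auto simp: cycle_graph_def)
      consider "i < j" | "j < i" | "i = j" by linarith
      then show ?thesis
      proof cases
        case 2
        then show ?thesis using le[of j i] that swap edge_sym by blast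
      next
        case 3
        have "i = 0 \<or> i = 1 \<or> i = 2 \<or> i = 3 \<or> i = 4" using that by linarith
        then show ?thesis using 3 unfolding cycle_graph_def by (elim disjE; simp)
      qed (use le that in blast)
    qed
    have arcs_eq: "parcs G = map_prod c c ` parcs (cycle_graph 5)"
    proof
      show "map_prod c c ` parcs (cycle_graph 5) \<subseteq> parcs G"
        using adj_iff by (auto simp: cycle_graph_def)
      show "parcs G \<subseteq> map_prod c c ` parcs (cycle_graph 5)"
      proof (rule subrelI)
        fix p q assume pq: "(p, q) \<in> parcs G"
        then have "p \<in> c ` {..<5}" "q \<in> c ` {..<5}"
          using arcs_C bij_betw_imp_surj_on[OF bc] by auto
        then obtain i j where "p = c i" "q = c j" "i < 5" "j < 5" by auto
        then show "(p, q) \<in> map_prod c c ` parcs (cycle_graph 5)"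
          using pq adj_iff[of i j] by force
      qed
    qed
    have fc: "f (c i) = Inl i" if "i < 5" for i
      using idx_c[OF that] by (simp add: f_def c_def)
    have "map_prod f f ` parcs G = (\<lambda>e. map_prod f f (map_prod c c e)) ` parcs (cycle_graph 5)"
      unfolding arcs_eq by (rule image_image)
    also have "\<dots> = map_prod Inl Inl ` parcs (cycle_graph 5)"
    proof (rule image_cong[OF refl])
      fix e assume "e \<in> parcs (cycle_graph 5)"
      then have "fst e < 5" "snd e < 5" by (auto simp: cycle_graph_def)
      then show "map_prod f f (map_prod c c e) = map_prod Inl Inl e"
        by (simp add: fc prod_eq_iff)
    qed
    finally show ?thesis by (simp add: add_isolated_def)
  qed
  ultimately show ?thesis using digraph_iso_pairI[OF P.pair_wf_digraph_axioms] by blast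
qed

section \<open>Matrix powers and eigenvalues in terms of walks and vertex functions\<close>

locale adjacency_list = edge_relation "pverts G" "parcs G"
  for G :: "'a pair_pre_digraph" +
  fixes vs :: "'a list"
  assumes vs: "distinct vs" "set vs = pverts G"
begin

abbreviation "A \<equiv> adjacency_matrix vs G"

lemma A_carrier: "A \<in> carrier_mat (length vs) (length vs)"
  by (simp add: adjacency_matrix_def)

lemma A_index: "i < length vs \<Longrightarrow> j < length vs \<Longrightarrow> A $$ (i, j) = adj (vs ! i) (vs ! j)"
  by (simp add: adjacency_matrix_def adj_def)

lemma A_pow_index:
  "i < length vs \<Longrightarrow> j < length vs \<Longrightarrow> (A ^\<^sub>m r) $$ (i, j) = walks r (vs ! i) (vs ! j)"
proof (induction r arbitrary: j)
  case 0
  then show ?case using vs(1) A_carrier by (simp add: nth_eq_iff_index_eq)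
next
  case (Suc r)
  have P: "A ^\<^sub>m r \<in> carrier_mat (length vs) (length vs)" using A_carrier by simp
  have "(A ^\<^sub>m Suc r) $$ (i, j) = (\<Sum>l<length vs. (A ^\<^sub>m r) $$ (i, l) * A $$ (l, j))"
    using Suc.prems P A_carrier by (simp add: scalar_prod_def atLeast0LessThan)
  also have "\<dots> = (\<Sum>l<length vs. walks r (vs ! i) (vs ! l) * adj (vs ! l) (vs ! j))"
    by (intro sum.cong refl) (simp add: Suc A_index)
  also have "\<dots> = walks (Suc r) (vs ! i) (vs ! j)"
    by (simp add: sum_over_list[OF vs])
  finally show ?case .
qed

lemma trace_A_pow: "mat_trace (A ^\<^sub>m r) = (\<Sum>v\<in>pverts G. walks r v v)"
  using A_carrier by (simp add: mat_trace_def sum_over_list[OF vs] A_pow_index)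

lemma eigenvalue_A_iff:
  "eigenvalue A e \<longleftrightarrow> (\<exists>x. (\<exists>v\<in>pverts G. x v \<noteq> 0) \<and>
    (\<forall>v\<in>pverts G. (\<Sum>w\<in>pverts G. adj v w * x w) = e * x v))"
  (is "_ \<longleftrightarrow> (\<exists>x. ?Q x)")
proof
  have mult: "(A *\<^sub>v y) $ i = (\<Sum>l<length vs. adj (vs ! i) (vs ! l) * y $ l)"
    if "y \<in> carrier_vec (length vs)" "i < length vs" for y i
    using that A_carrier by (simp add: scalar_prod_def atLeast0LessThan A_index)
  have bij: "bij_betw ((!) vs) {..<length vs} (pverts G)"
    using bij_betw_nth[OF vs(1)] vs(2) by simp
  show "\<exists>x. ?Q x" if "eigenvalue A e"
  proof -
    have "dim_row A = length vs" using A_carrier by simp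
    then obtain y where y: "y \<in> carrier_vec (length vs)" "y \<noteq> 0\<^sub>v (length vs)" "A *\<^sub>v y = e \<cdot>\<^sub>v y"
      using \<open>eigenvalue A e\<close> unfolding eigenvalue_def eigenvector_def by metis
    define x where "x = (\<lambda>v. y $ (the_inv_into {..<length vs} ((!) vs) v))"
    have x: "x (vs ! i) = y $ i" if "i < length vs" for i
      using that bij by (simp add: x_def the_inv_into_f_f bij_betw_def)
    have "\<exists>i<length vs. y $ i \<noteq> 0"
    proof (rule ccontr)
      assume "\<not> ?thesis"
      then have "y = 0\<^sub>v (length vs)" using y(1) by (intro eq_vecI) auto
      then show False using y(2) by simp
    qed
    then obtain i where i: "i < length vs" "y $ i \<noteq> 0" by blast
    have "vs ! i \<in> pverts G" using nth_mem[OF i(1)] unfolding vs(2) .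
    moreover have "x (vs ! i) \<noteq> 0" using x[OF i(1)] i(2) by simp
    ultimately have "\<exists>v\<in>pverts G. x v \<noteq> 0" by blast
    moreover have "(\<Sum>w\<in>pverts G. adj v w * x w) = e * x v" if v: "v \<in> pverts G" for v
    proof -
      have "v \<in> set vs" using v vs(2) by simp
      then obtain i where i: "i < length vs" "v = vs ! i" by (auto simp: in_set_conv_nth)
      have "(\<Sum>w\<in>pverts G. adj v w * x w) = (A *\<^sub>v y) $ i"
        unfolding sum_over_list[OF vs] mult[OF y(1) i(1)] i(2)
        by (intro sum.cong refl) (simp add: x)
      also have "\<dots> = e * y $ i" using y(1,3) i(1) by simp
      finally show ?thesis using x[OF i(1)] i(2) by simp
    qed
    ultimately show ?thesis by blast
  qed
  show "eigenvalue A e" if Q: "\<exists>x. ?Q x"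
  proof -
    obtain x where x: "\<exists>v\<in>pverts G. x v \<noteq> 0"
      "\<And>v. v \<in> pverts G \<Longrightarrow> (\<Sum>w\<in>pverts G. adj v w * x w) = e * x v"
      using Q by blast
    define y where "y = vec (length vs) (\<lambda>i. x (vs ! i))"
    obtain v where "v \<in> set vs" "x v \<noteq> 0" using x(1) unfolding vs(2) by blast
    then obtain i where i: "i < length vs" "x (vs ! i) \<noteq> 0" by (auto simp: in_set_conv_nth)
    have "y $ i \<noteq> 0\<^sub>v (length vs) $ i" using i by (simp add: y_def)
    then have "y \<noteq> 0\<^sub>v (length vs)" by metis
    moreover have "A *\<^sub>v y = e \<cdot>\<^sub>v y"
    proof (rule eq_vecI)
      fix l assume "l < dim_vec (e \<cdot>\<^sub>v y)"
      then have l: "l < length vs" by (simp add: y_def)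
      then have "(A *\<^sub>v y) $ l = (\<Sum>w\<in>pverts G. adj (vs ! l) w * x w)"
        by (subst mult) (auto simp: y_def sum_over_list[OF vs])
      also have "\<dots> = e * x (vs ! l)" using x(2) l vs(2) nth_mem by blast
      finally show "(A *\<^sub>v y) $ l = (e \<cdot>\<^sub>v y) $ l" using l by (simp add: y_def)
    qed (use A_carrier in \<open>simp add: y_def\<close>)
    ultimately show ?thesis
      using A_carrier unfolding eigenvalue_def eigenvector_def
      by (intro exI[of _ y]) (simp add: y_def)
  qed
qed

end

text \<open>Passes from the family to all eigenvalues. Positive ones follow from the Rayleigh
  quotient; the others lie below \<open>\<nu> i\<close>, which dominates its own modulus and so is
  nonnegative.\<close>

lemma (in spectral_edge_relation) top_is_largest:
  assumes i: "i < m" "\<And>l. l < m \<Longrightarrow> \<bar>\<nu> l\<bar> \<le> \<nu> i"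
    and x: "v \<in> V" "x v \<noteq> 0" "\<And>v. v \<in> V \<Longrightarrow> (\<Sum>w\<in>V. adj v w * x w) = e * x v"
  shows "e \<le> \<nu> i"
proof (cases "0 < e")
  case True
  have "quad x = e * nsq x"
  proof -
    have "quad x = (\<Sum>v\<in>V. x v * (e * x v))"
      unfolding quad_eq by (intro sum.cong refl) (simp add: x(3))
    then show ?thesis by (simp add: nsq_def power2_eq_square sum_distrib_left mult_ac)
  qed
  then obtain j where "j < m" "e \<le> \<nu> j"
    using eigenvalue_ge_of_quad[OF True nsq_pos[of v x], of UNIV] x by auto
  then show ?thesis using i(2)[of j] by linarith
next
  case False
  then show ?thesis using i(2)[OF i(1)] by linarith
qed

context spectral_odd_cycle
begin

lemma top_eigenvalue_exists:
  obtains i where "i < m" "\<And>l. l < m \<Longrightarrow> \<bar>\<nu> l\<bar> \<le> \<nu> i"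
proof -
  obtain j where "j < m" "2 \<le> \<nu> j"
    using eigenvalue_ge_of_quad[OF _ subeigen_nsq_pos[OF subeigen_C] subeigen_quad[OF subeigen_C], of UNIV]
    by auto
  then have "0 < m" by simp
  then obtain i where "i < m" "\<And>l. l < m \<Longrightarrow> \<bar>\<nu> l\<bar> \<le> \<nu> i"
    using top_eigenvalue by blast
  then show ?thesis by (rule that)
qed

lemma trace_two: "(\<Sum>v\<in>V. walks 2 v v) = card E"
proof -
  have "walks 2 v v = card (nbrs v)" if v: "v \<in> V" for v
  proof -
    have "walks 1 v w = adj v w" for w
    proof -
      have "walks 1 v w = (\<Sum>z\<in>V. if z = v then adj z w else 0)"
        by (simp add: of_bool_def if_distrib[of "\<lambda>r. r * _"] eq_commute[of v] cong: if_cong)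
      then show ?thesis using v fin by simp
    qed
    then have "walks 2 v v = (\<Sum>w\<in>V. adj v w * adj w v)"
      by (simp add: numeral_2_eq_2)
    also have "\<dots> = (\<Sum>w\<in>nbrs v. 1)"
      unfolding sum_adj using edge_sym by (intro sum.cong) (auto simp: nbrs_def adj_def)
    finally show ?thesis by simp
  qed
  then have "(\<Sum>v\<in>V. walks 2 v v) = real (\<Sum>v\<in>V. card (nbrs v))" by simp
  also have "(\<Sum>v\<in>V. card (nbrs v)) = card (Sigma V nbrs)" using fin by simp
  also have "Sigma V nbrs = E" using edge_in by (auto simp: nbrs_def)
  finally show ?thesis .
qed

end

theorem theorem1p3:
  fixes G :: "'a pair_pre_digraph" and vs :: "'a list" and k :: nat
  defines "A \<equiv> adjacency_matrix vs G"
  assumes "pair_graph G"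
    and "distinct vs" and "set vs = pverts G"
    and "k \<ge> 1"
    and "\<not> bipartite G"
    and "\<And>i. 1 \<le> i \<Longrightarrow> i \<le> k \<Longrightarrow> \<not> contains_subgraph G (cycle_graph (2 * i + 1))"
  shows "largest_eigenvalue A ^ (2 * k)
           \<le> mat_trace (A ^\<^sub>m (2 * k)) / 2 - (2 * cos (pi / real (k + 2))) ^ (2 * k)
       \<and> (largest_eigenvalue A ^ (2 * k)
            = mat_trace (A ^\<^sub>m (2 * k)) / 2 - (2 * cos (pi / real (k + 2))) ^ (2 * k)
          \<longleftrightarrow> k = 1 \<and>
              (\<exists>s. digraph_iso (with_proj G) (with_proj (add_isolated s (cycle_graph 5)))))"
proof -
  interpret edge_relation "pverts G" "parcs G"
    using edge_relation_of_pair_graph[OF assms(2)] .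
  interpret adjacency_list G vs
    using assms by unfold_locales
  obtain g C where C: "shortest_odd_cycle (pverts G) (parcs G) g C"
    using shortest_odd_cycle_exists assms(6) unfolding bipartite_def by blast
  interpret shortest_odd_cycle "pverts G" "parcs G" g C by (rule C)
  have g: "2 * k + 3 \<le> g"
  proof (rule ccontr)
    assume "\<not> 2 * k + 3 \<le> g"
    moreover obtain i where i: "g = 2 * i + 1" using odd_g by (elim oddE)
    ultimately have "1 \<le> i" "i \<le> k" using g_ge3 by auto
    then show False using assms(7) contains_shortest_odd_cycle[OF assms(2) C] i by simp
  qed
  obtain m u \<nu> where "spectral_edge_relation (pverts G) (parcs G) m u \<nu>"
    using spectral_decomposition_exists .
  then interpret spectral_edge_relation "pverts G" "parcs G" m u \<nu> .
  interpret spectral_odd_cycle "pverts G" "parcs G" m u \<nu> g C ..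
  obtain i where i: "i < m" "\<And>l. l < m \<Longrightarrow> \<bar>\<nu> l\<bar> \<le> \<nu> i"
    using top_eigenvalue_exists by blast
  have ui: "\<exists>v\<in>pverts G. u i v \<noteq> 0"
  proof (rule ccontr)
    assume "\<not> ?thesis"
    then have "nsq (u i) = 0" by (simp add: nsq_def)
    then show False using nsq_unit[OF i(1)] by simp
  qed
  have top: "largest_eigenvalue A = \<nu> i"
    unfolding largest_eigenvalue_def A_def spectrum_def
  proof (rule Max_eqI)
    show "finite (Collect (eigenvalue (adjacency_matrix vs G)))"
      using card_finite_spectrum(1)[OF A_carrier] by (simp add: spectrum_def)
    show "\<nu> i \<in> Collect (eigenvalue (adjacency_matrix vs G))"
      using eigenvalue_A_iff ui eigen[OF i(1)] by blast
    show "e \<le> \<nu> i" if e: "e \<in> Collect (eigenvalue (adjacency_matrix vs G))" for e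
    proof -
      obtain x v where xv: "v \<in> pverts G" "x v \<noteq> 0"
        and ex: "\<And>v. v \<in> pverts G \<Longrightarrow> (\<Sum>w\<in>pverts G. adj v w * x w) = e * x v"
        using e unfolding mem_Collect_eq eigenvalue_A_iff by blast
      show ?thesis by (rule top_is_largest[where v = v and x = x, OF i xv ex])
    qed
  qed
  have tr: "mat_trace (A ^\<^sub>m (2 * k)) = (\<Sum>v\<in>pverts G. walks (2 * k) v v)"
    unfolding A_def by (rule trace_A_pow)
  show ?thesis
  proof (cases "k = 1")
    case False
    then have "k \<ge> 2" using assms(5) by simp
    from trace_gt_of_long_odd_girth[OF this g i] False show ?thesis
      unfolding top tr by auto
  next
    case True
    have g5: "5 \<le> g" using g True by simp
    have bound: "2 * (\<nu> i)\<^sup>2 + 2 \<le> card (parcs G)"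
      "2 * (\<nu> i)\<^sup>2 + 2 = card (parcs G) \<Longrightarrow> (\<nu> i)\<^sup>2 = 4"
      using triangle_free_bound[OF g5 eigen[OF i(1)] ui] by blast+
    have "2 * (\<nu> i)\<^sup>2 + 2 = card (parcs G) \<longleftrightarrow>
      (\<exists>s. digraph_iso (with_proj G) (with_proj (add_isolated s (cycle_graph 5))))"
    proof
      assume eq: "2 * (\<nu> i)\<^sup>2 + 2 = card (parcs G)"
      then have "card (parcs G) = 10" using bound(2) by simp
      from arcs_of_card_10[OF g5 this]
      show "\<exists>s. digraph_iso (with_proj G) (with_proj (add_isolated s (cycle_graph 5)))"
        using iso_C5_with_isolated_vertices[OF assms(2)] C by blast
    next
      assume "\<exists>s. digraph_iso (with_proj G) (with_proj (add_isolated s (cycle_graph 5)))"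
      then obtain s where "digraph_iso (with_proj G) (with_proj (add_isolated s (cycle_graph 5)))" ..
      from digraph_iso_card_arcs[OF this]
      have "card (parcs G) = card (map_prod Inl Inl ` parcs (cycle_graph 5) :: ((nat + nat) \<times> (nat + nat)) set)"
        by (simp add: add_isolated_def)
      also have "\<dots> = card (parcs (cycle_graph 5))"
        by (intro card_image) (auto simp: inj_on_def)
      finally have c10: "card (parcs G) = 10" by (simp add: card_arcs_C5)
      \<comment> \<open>Ten arcs bound \<open>(\<nu> i)\<^sup>2\<close> by 4 from above, and the odd
        cycle bounds it by 4 from below.\<close>
      have "2\<^sup>2 \<le> (\<nu> i)\<^sup>2" using two_le_top[OF i] by (intro power_mono) auto
      then show "2 * (\<nu> i)\<^sup>2 + 2 = card (parcs G)" using bound(1) c10 by simp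
    qed
    moreover have two_k: "2 * k = 2" using True by simp
    have trace: "mat_trace (A ^\<^sub>m (2 * k)) = card (parcs G)"
      unfolding two_k by (rule trans[OF tr[unfolded two_k] trace_two])
    \<comment> \<open>For \<open>k = 1\<close> the angle is \<open>pi / 3\<close>, so the subtracted
      term is 1; doubled, it is the summand 2 in \<open>bound\<close>.\<close>
    have cos: "(2 * cos (pi / real (k + 2))) ^ (2 * k) = 1"
      using True by (simp add: cos_60)
    have "(\<nu> i)\<^sup>2 = card (parcs G) / 2 - 1 \<longleftrightarrow> 2 * (\<nu> i)\<^sup>2 + 2 = card (parcs G)" by auto
    moreover have "(\<nu> i)\<^sup>2 \<le> card (parcs G) / 2 - 1" using bound(1) by simp
    ultimately show ?thesis
      unfolding top trace cos unfolding two_k using True by blast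
  qed
qed

end
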